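(* Let $0<\gamma\le\infty$ and let $\psi:[0,\gamma)\to[0,\infty)$ be a non-zero increasing concave function, continuous on $(0,\gamma)$, with $\psi(0)=0$. If the dual space $M_\psi(0,\gamma)^*$ has order continuous norm, then either condition (A) or condition (B) is satisfied.
   Context: For $f\in L_0(0,\gamma)$ (Lebesgue measure), $f^*$ denotes the decreasing rearrangement of $|f|$: $f^*(t)=\inf\{s\ge0: m(\{|f|>s\})\le t\}$. The Marcinkiewicz space is $M_\psi(0,\gamma)=\{f\in L_0(0,\gamma):\|f\|_{M_\psi}<\infty\}$ with $\|f\|_{M_\psi}=\sup_{0<t<\gamma}\frac{1}{\psi(t)}\int_0^t f^*(s)\,ds$; it is a Banach lattice under the a.e. order. Condition (A): $\gamma=\infty$ and $\liminf_{t\downarrow0}\psi(2t)/\psi(t)>1$ and $\liminf_{t\to\infty}\psi(2t)/\psi(t)>1$. Condition (B): $\gamma<\infty$ and $\liminf_{t\downarrow0}\psi(2t)/\psi(t)>1$. *)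

theory Defs
  imports "HOL-Analysis.Analysis"
begin

definition ivl :: "ereal \<Rightarrow> real set" where
  "ivl \<gamma> = {x. 0 < x \<and> ereal x < \<gamma>}"

definition distr_fn :: "ereal \<Rightarrow> (real \<Rightarrow> real) \<Rightarrow> ennreal \<Rightarrow> ennreal" where
  "distr_fn \<gamma> f s = emeasure lebesgue {x \<in> ivl \<gamma>. s < ennreal \<bar>f x\<bar>}"

text \<open>Decreasing rearrangement f*(t) = inf {s \<ge> 0. m(|f| > s) \<le> t} (value \<infinity> if the set is empty).\<close>
definition rearr :: "ereal \<Rightarrow> (real \<Rightarrow> real) \<Rightarrow> real \<Rightarrow> ennreal" where
  "rearr \<gamma> f t = Inf {s. distr_fn \<gamma> f s \<le> ennreal t}"

definition M_norm :: "ereal \<Rightarrow> (real \<Rightarrow> real) \<Rightarrow> (real \<Rightarrow> real) \<Rightarrow> ennreal" where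
  "M_norm \<gamma> \<psi> f = (SUP t \<in> ivl \<gamma>. (\<integral>\<^sup>+ s \<in> {0<..<t}. rearr \<gamma> f s \<partial>lborel) / ennreal (\<psi> t))"

text \<open>The Marcinkiewicz space M_psi(0,gamma) (as a set of representatives).\<close>
definition M_space :: "ereal \<Rightarrow> (real \<Rightarrow> real) \<Rightarrow> (real \<Rightarrow> real) set" where
  "M_space \<gamma> \<psi> = {f. set_borel_measurable lebesgue (ivl \<gamma>) f \<and> M_norm \<gamma> \<psi> f < \<infinity>}"

definition M_rnorm :: "ereal \<Rightarrow> (real \<Rightarrow> real) \<Rightarrow> (real \<Rightarrow> real) \<Rightarrow> real" where
  "M_rnorm \<gamma> \<psi> f = enn2real (M_norm \<gamma> \<psi> f)"

definition M_dual :: "ereal \<Rightarrow> (real \<Rightarrow> real) \<Rightarrow> ((real \<Rightarrow> real) \<Rightarrow> real) set" where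
  "M_dual \<gamma> \<psi> = {F. (\<forall>f\<in>M_space \<gamma> \<psi>. \<forall>g\<in>M_space \<gamma> \<psi>. F (\<lambda>x. f x + g x) = F f + F g)
      \<and> (\<forall>f\<in>M_space \<gamma> \<psi>. \<forall>c::real. F (\<lambda>x. c * f x) = c * F f)
      \<and> (\<exists>C. \<forall>f\<in>M_space \<gamma> \<psi>. \<bar>F f\<bar> \<le> C * M_rnorm \<gamma> \<psi> f)}"

definition dual_norm :: "ereal \<Rightarrow> (real \<Rightarrow> real) \<Rightarrow> ((real \<Rightarrow> real) \<Rightarrow> real) \<Rightarrow> real" where
  "dual_norm \<gamma> \<psi> F = Sup {\<bar>F f\<bar> | f. f \<in> M_space \<gamma> \<psi> \<and> M_rnorm \<gamma> \<psi> f \<le> 1}"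

definition dual_le :: "ereal \<Rightarrow> (real \<Rightarrow> real) \<Rightarrow> ((real \<Rightarrow> real) \<Rightarrow> real) \<Rightarrow> ((real \<Rightarrow> real) \<Rightarrow> real) \<Rightarrow> bool" where
  "dual_le \<gamma> \<psi> F G \<longleftrightarrow> (\<forall>f\<in>M_space \<gamma> \<psi>.
      (AE x in lebesgue. x \<in> ivl \<gamma> \<longrightarrow> 0 \<le> f x) \<longrightarrow> F f \<le> G f)"

text \<open>Order continuous norm of the dual: for every downward directed set D with
  infimum 0 in the dual lattice, inf of the norms over D is 0 (i.e. x_alpha \<down> 0 implies
  norm x_alpha \<rightarrow> 0).\<close>
definition dual_order_continuous :: "ereal \<Rightarrow> (real \<Rightarrow> real) \<Rightarrow> bool" where
  "dual_order_continuous \<gamma> \<psi> \<longleftrightarrow>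
     (\<forall>D. D \<subseteq> M_dual \<gamma> \<psi> \<and> D \<noteq> {}
        \<and> (\<forall>F\<in>D. \<forall>G\<in>D. \<exists>H\<in>D. dual_le \<gamma> \<psi> H F \<and> dual_le \<gamma> \<psi> H G)
        \<and> (\<forall>F\<in>D. dual_le \<gamma> \<psi> (\<lambda>f. 0) F)
        \<and> (\<forall>H\<in>M_dual \<gamma> \<psi>. (\<forall>F\<in>D. dual_le \<gamma> \<psi> H F) \<longrightarrow> dual_le \<gamma> \<psi> H (\<lambda>f. 0))
      \<longrightarrow> (INF F\<in>D. dual_norm \<gamma> \<psi> F) = 0)"

definition condA :: "ereal \<Rightarrow> (real \<Rightarrow> real) \<Rightarrow> bool" where
  "condA \<gamma> \<psi> \<longleftrightarrow> \<gamma> = \<infinity>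
     \<and> Liminf (at_right 0) (\<lambda>t. ereal (\<psi> (2*t) / \<psi> t)) > 1
     \<and> Liminf at_top (\<lambda>t. ereal (\<psi> (2*t) / \<psi> t)) > 1"

definition condB :: "ereal \<Rightarrow> (real \<Rightarrow> real) \<Rightarrow> bool" where
  "condB \<gamma> \<psi> \<longleftrightarrow> \<gamma> < \<infinity>
     \<and> Liminf (at_right 0) (\<lambda>t. ereal (\<psi> (2*t) / \<psi> t)) > 1"

end

theory Submission
  imports Defs
begin

text \<open>If neither (A) nor (B) holds, then \<open>\<psi>(2t)/\<psi>(t)\<close> comes arbitrarily close to \<open>1\<close> as
  \<open>t \<rightarrow> 0\<close>, or \<open>\<gamma> = \<infinity>\<close> and it does so as \<open>t \<rightarrow> \<infinity>\<close>. In either case we find positive functionals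
  \<open>\<Psi>\<^sub>j\<close> on \<open>M\<^sub>\<psi>\<close> with \<open>\<Sum>\<^sub>j\<^sub><\<^sub>N \<Psi>\<^sub>j(|f|) \<le> C\<parallel>f\<parallel>\<close> for all \<open>N\<close>, and nonnegative unit vectors
  \<open>h\<^sub>j\<close> with \<open>\<Psi>\<^sub>j(h\<^sub>j) \<ge> c > 0\<close>. The tails \<open>\<Sum>\<^sub>j\<^sub>\<ge>\<^sub>n \<Psi>\<^sub>j\<close> then decrease to \<open>0\<close> in the dual
  lattice while their norms stay \<open>\<ge> c\<close>.

  If \<open>\<psi>\<close> is bounded away from \<open>0\<close> (or bounded, when \<open>\<gamma> = \<infinity>\<close>), \<open>\<Psi>\<^sub>j\<close> integrates over the
  \<open>j\<close>-th of a sequence of disjoint dyadic intervals. Otherwise, since by concavity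
  \<open>\<psi>(Kt) \<le> \<psi>(t) + (K - 1)(\<psi>(2t) - \<psi>(t))\<close>, there are points \<open>t\<^sub>k\<close> with
  \<open>\<psi>((k + 8)t\<^sub>k) \<le> 2\<psi>(t\<^sub>k)\<close>; they are chosen so that the intervals \<open>(t\<^sub>k, (k + 8)t\<^sub>k)\<close> are
  disjoint and \<open>\<psi>((k + 8)t\<^sub>k)\<close> halves (resp. doubles) from one to the next. \<open>\<Psi>\<^sub>j\<close> is a Banach limit
  over \<open>k\<close> of averages over the \<open>j\<close>-th cell of length \<open>t\<^sub>k\<close> in \<open>(t\<^sub>k, (k + 8)t\<^sub>k)\<close>, and the
  geometric growth is what keeps the test vectors in the unit ball.\<close>

section \<open>Ultrafilter limits\<close>

definition ultrafilter :: "'a filter \<Rightarrow> bool" where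
  "ultrafilter U \<longleftrightarrow> U \<noteq> bot \<and> (\<forall>P. eventually P U \<or> eventually (\<lambda>x. \<not> P x) U)"

lemma ultrafilter_not_bot: "ultrafilter U \<Longrightarrow> U \<noteq> bot"
  by (simp add: ultrafilter_def)

lemma ex_maximal_proper_filter_le:
  fixes F :: "'a filter"
  assumes F: "F \<noteq> bot"
  shows "\<exists>U. U \<noteq> bot \<and> U \<le> F \<and> (\<forall>G. G \<noteq> bot \<longrightarrow> G \<le> U \<longrightarrow> G = U)"
proof -
  let ?R = "{(b, a). a \<noteq> bot \<and> a \<le> b \<and> b \<le> F}"
  have bot_notin_R: "c \<in> Chains ?R \<Longrightarrow> bot \<notin> c" for c
    by (auto simp: Chains_def)
  have [simp]: "Field ?R = {G. G \<noteq> bot \<and> G \<le> F}"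
    by (auto simp: Field_def bot_unique)
  have "\<exists>m\<in>Field ?R. \<forall>a\<in>Field ?R. (m, a) \<in> ?R \<longrightarrow> a = m"
  proof (rule Zorns_po_lemma)
    show "Partial_order ?R"
      by (auto simp: partial_order_on_def preorder_on_def
          antisym_def refl_on_def trans_def Field_def bot_unique)
    show "\<exists>u\<in>Field ?R. \<forall>a\<in>C. (a, u) \<in> ?R" if C: "C \<in> Chains ?R" for C
    proof (simp, intro exI conjI ballI)
      have Inf_C: "Inf C \<noteq> bot" "Inf C \<le> F" if "C \<noteq> {}"
      proof -
        from C that have "Inf C = bot \<longleftrightarrow> (\<exists>x\<in>C. x = bot)"
          unfolding trivial_limit_def by (intro eventually_Inf_base) (auto simp: Chains_def)
        with C show "Inf C \<noteq> bot"
          by (simp add: bot_notin_R)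
        from that obtain x where "x \<in> C" by auto
        with C show "Inf C \<le> F"
          by (auto intro!: Inf_lower2[of x] simp: Chains_def)
      qed
      then have [simp]: "inf F (Inf C) = (if C = {} then F else Inf C)"
        using C by (auto simp add: inf_absorb2)
      from C show "inf F (Inf C) \<noteq> bot"
        by (simp add: F Inf_C)
      from C show "inf F (Inf C) \<le> F"
        by (simp add: Chains_def Inf_C F)
      with C show "inf F (Inf C) \<le> x" "x \<le> F" if "x \<in> C" for x
        using that by (auto intro: Inf_lower simp: Chains_def)
    qed
  qed
  then show ?thesis
    by auto
qed

lemma maximal_proper_filter_ultrafilter:
  assumes U: "U \<noteq> bot" and max: "\<And>G. G \<noteq> bot \<Longrightarrow> G \<le> U \<Longrightarrow> G = U"
  shows "ultrafilter U"
  unfolding ultrafilter_def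
proof (intro conjI allI disjCI)
  show "U \<noteq> bot" by (rule U)
  fix P
  assume "\<not> (\<forall>\<^sub>F x in U. \<not> P x)"
  then have "inf U (principal {x. P x}) \<noteq> bot"
    by (simp add: trivial_limit_def eventually_inf_principal not_eventually)
  then have "inf U (principal {x. P x}) = U"
    by (rule max) simp
  moreover have "eventually P (inf U (principal {x. P x}))"
    by (simp add: eventually_inf_principal)
  ultimately show "eventually P U"
    by simp
qed

lemma ex_ultrafilter_le:
  fixes F :: "'a filter"
  assumes "F \<noteq> bot"
  shows "\<exists>U\<le>F. ultrafilter U"
  using ex_maximal_proper_filter_le[OF assms] maximal_proper_filter_ultrafilter by blast

text \<open>Limits along an ultrafilter play the role of Banach limits.\<close>

lemma ultrafilter_tendsto_Lim:
  fixes x :: "'a \<Rightarrow> real"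
  assumes U: "ultrafilter U" and B: "\<And>k. \<bar>x k\<bar> \<le> B"
  shows "(x \<longlongrightarrow> Lim U x) U"
proof -
  have "filtermap x U \<noteq> bot"
    using U by (simp add: ultrafilter_def filtermap_bot_iff)
  moreover have "eventually (\<lambda>y. y \<in> {-B..B}) (filtermap x U)"
    using B by (auto simp: eventually_filtermap abs_le_iff intro!: always_eventually)
      (metis minus_le_iff)
  ultimately obtain l where l: "inf (nhds l) (filtermap x U) \<noteq> bot"
    using compact_Icc[of "-B" B, unfolded compact_filter] by blast
  have "(x \<longlongrightarrow> l) U"
    unfolding tendsto_def
  proof (intro allI impI)
    fix S :: "real set"
    assume S: "open S" "l \<in> S"
    show "eventually (\<lambda>n. x n \<in> S) U"
    proof (rule ccontr)
      assume "\<not> eventually (\<lambda>n. x n \<in> S) U"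
      then have "eventually (\<lambda>y. y \<notin> S) (filtermap x U)"
        using U by (auto simp: ultrafilter_def eventually_filtermap)
      moreover have "eventually (\<lambda>y. y \<in> S) (nhds l)"
        using S by (rule eventually_nhds_in_open)
      ultimately have "eventually (\<lambda>y. False) (inf (nhds l) (filtermap x U))"
        unfolding eventually_inf by blast
      with l show False
        by (simp add: trivial_limit_def)
    qed
  qed
  moreover from this have "Lim U x = l"
    using ultrafilter_not_bot[OF U] by (rule tendsto_Lim[rotated])
  ultimately show ?thesis
    by simp
qed

section \<open>Distribution functions and decreasing rearrangements\<close>

lemma sigma_finite_lebesgue: "sigma_finite_measure (lebesgue :: real measure)"
proof
  show "\<exists>A::real set set. countable A \<and> A \<subseteq> sets lebesgue \<and> \<Union>A = space lebesgue
      \<and> (\<forall>a\<in>A. emeasure lebesgue a \<noteq> \<infinity>)"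
  proof (intro exI[of _ "range (\<lambda>n::nat. {- real n <..< real n})"] conjI)
    show "\<Union> (range (\<lambda>n::nat. {- real n<..<real n})) = space lebesgue"
    proof auto
      fix x :: real
      obtain n :: nat where "\<bar>x\<bar> < real n"
        using reals_Archimedean2 by blast
      then show "\<exists>n. - real n < x \<and> x < real n"
        by (intro exI[of _ n]) arith
    qed
  qed auto
qed

lemma ivl_in_borel [measurable]: "ivl \<gamma> \<in> sets borel"
proof -
  have "{x::real. 0 < x \<and> ereal x < \<gamma>} \<in> sets borel"
    by measurable
  then show ?thesis
    by (simp add: ivl_def)
qed

lemma downward_closed_in_borel:
  fixes D :: "real set"
  assumes down: "\<And>x z. z \<in> D \<Longrightarrow> x \<le> z \<Longrightarrow> x \<in> D"
  shows "D \<in> sets borel"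
proof (cases "D = UNIV \<or> D = {}")
  case True
  then show ?thesis by auto
next
  case False
  then obtain b where b: "b \<notin> D" and ne: "D \<noteq> {}"
    by auto
  have "z < b" if "z \<in> D" for z
    using down[of z b] that b by force
  then have bdd: "bdd_above D"
    by (meson bdd_above.I less_imp_le)
  have "D = {..Sup D} \<or> D = {..<Sup D}"
  proof (cases "Sup D \<in> D")
    case True
    then show ?thesis
      using down cSup_upper[OF _ bdd] by auto
  next
    case False
    have "x \<in> D \<longleftrightarrow> x < Sup D" for x
    proof
      show "x \<in> D \<Longrightarrow> x < Sup D"
        using cSup_upper[OF _ bdd, of x] False by (metis order_le_less)
      show "x < Sup D \<Longrightarrow> x \<in> D"
        using less_cSup_iff[OF ne bdd, of x] down by auto
    qed
    then show ?thesis
      by auto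
  qed
  then show ?thesis
    by (elim disjE) (erule ssubst, simp)+
qed

lemma borel_measurable_antimono_ennreal:
  fixes F :: "real \<Rightarrow> ennreal"
  assumes "\<And>x y. x \<le> y \<Longrightarrow> F y \<le> F x"
  shows "F \<in> borel_measurable borel"
proof (rule borel_measurableI_greater)
  fix y
  have "{x. y < F x} \<in> sets borel"
    by (rule downward_closed_in_borel) (use assms in \<open>auto intro: less_le_trans\<close>)
  then show "{x \<in> space borel. y < F x} \<in> sets borel"
    by simp
qed

lemma emeasure_lborel_greaterThan [simp]: "emeasure lborel {a::real<..} = \<infinity>"
proof (rule ccontr)
  assume "emeasure lborel {a<..} \<noteq> \<infinity>"
  then obtain r where r: "emeasure lborel {a<..} = ennreal r" "0 \<le> r"
    by (cases "emeasure lborel {a<..}") auto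
  have "emeasure lborel {a<..<a + r + 1} \<le> emeasure lborel {a<..}"
    by (rule emeasure_mono) auto
  with r show False
    by (simp add: ennreal_le_iff)
qed

lemma nn_integral_layer_cake:
  fixes g :: "'a \<Rightarrow> ennreal"
  assumes sf: "sigma_finite_measure M" and g[measurable]: "g \<in> borel_measurable M"
  shows "(\<integral>\<^sup>+ x. g x \<partial>M)
    = (\<integral>\<^sup>+ s. indicator {0<..} s * emeasure M {x\<in>space M. ennreal s < g x} \<partial>lborel)"
proof -
  let ?L = "\<lambda>x. {s. 0 < s \<and> ennreal s < g x}"
  have layer: "g x = (\<integral>\<^sup>+ s. indicator (?L x) s \<partial>lborel)" for x
  proof (cases "g x")
    case (real r)
    then have "?L x = {0<..<r}"
      by (auto simp: ennreal_less_iff)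
    then show ?thesis
      using real by simp
  next
    case top
    then have "?L x = {0<..}"
      by auto
    then show ?thesis
      using top by simp
  qed
  interpret sigma_finite_measure M by (rule sf)
  interpret pair_sigma_finite M lborel ..
  have "Measurable.pred (M \<Otimes>\<^sub>M lborel) (\<lambda>(x, s). 0 < s \<and> ennreal s < g x)"
    by measurable
  then have m: "(\<lambda>(x, s). indicator (?L x) s :: ennreal) \<in> borel_measurable (M \<Otimes>\<^sub>M lborel)"
    by (simp add: indicator_def split_beta')
  have "(\<integral>\<^sup>+ x. g x \<partial>M) = (\<integral>\<^sup>+ x. (\<integral>\<^sup>+ s. indicator (?L x) s \<partial>lborel) \<partial>M)"
    by (subst layer) simp
  also have "\<dots> = (\<integral>\<^sup>+ s. (\<integral>\<^sup>+ x. indicator (?L x) s \<partial>M) \<partial>lborel)"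
    using Fubini'[of "\<lambda>x s. indicator (?L x) s"] m by simp
  also have "\<dots> = (\<integral>\<^sup>+ s. indicator {0<..} s * emeasure M {x\<in>space M. ennreal s < g x} \<partial>lborel)"
  proof (rule nn_integral_cong)
    fix s :: real
    have "(\<integral>\<^sup>+ x. indicator (?L x) s \<partial>M)
        = (\<integral>\<^sup>+ x. indicator {0<..} s * indicator {x\<in>space M. ennreal s < g x} x \<partial>M)"
      by (rule nn_integral_cong) (auto simp: indicator_def)
    also have "\<dots> = indicator {0<..} s * emeasure M {x\<in>space M. ennreal s < g x}"
      by (rule nn_integral_cmult_indicator) measurable
    finally show "(\<integral>\<^sup>+ x. indicator (?L x) s \<partial>M)
        = indicator {0<..} s * emeasure M {x\<in>space M. ennreal s < g x}" .
  qed
  finally show ?thesis .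
qed

lemma less_iff_ex_add_inverse_Suc: "(r::real) < y \<longleftrightarrow> (\<exists>n::nat. r + 1 / Suc n < y)"
proof
  assume "r < y"
  then obtain n where "1 / Suc n < y - r"
    by (metis diff_gt_0_iff_gt nat_approx_posE)
  then show "\<exists>n::nat. r + 1 / Suc n < y"
    by (intro exI[of _ n]) simp
next
  assume "\<exists>n::nat. r + 1 / Suc n < y"
  then obtain n :: nat where "r + 1 / Suc n < y" ..
  moreover have "0 < 1 / real (Suc n)"
    by simp
  ultimately show "r < y"
    by linarith
qed

lemma set_borel_measurable_ivlD:
  fixes f :: "real \<Rightarrow> real"
  assumes "set_borel_measurable lebesgue (ivl \<gamma>) f"
  shows "(\<lambda>x. indicator (ivl \<gamma>) x * f x) \<in> borel_measurable lebesgue"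
  using assms by (simp add: set_borel_measurable_def)

lemma distr_fn_set_in_lebesgue:
  assumes "set_borel_measurable lebesgue (ivl \<gamma>) f"
  shows "{x \<in> ivl \<gamma>. s < ennreal \<bar>f x\<bar>} \<in> sets lebesgue"
proof -
  have "{x \<in> ivl \<gamma>. s < ennreal \<bar>f x\<bar>}
      = {x \<in> space lebesgue. s < ennreal \<bar>indicator (ivl \<gamma>) x * f x\<bar>}"
    by (auto simp: indicator_def)
  also have "\<dots> \<in> sets lebesgue"
    using set_borel_measurable_ivlD[OF assms] by measurable
  finally show ?thesis .
qed

lemma distr_fn_antimono:
  assumes "set_borel_measurable lebesgue (ivl \<gamma>) f" "s \<le> s'"
  shows "distr_fn \<gamma> f s' \<le> distr_fn \<gamma> f s"
  unfolding distr_fn_def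
  by (rule emeasure_mono) (use assms distr_fn_set_in_lebesgue in \<open>auto intro: le_less_trans\<close>)

lemma distr_fn_right_continuous:
  assumes meas: "set_borel_measurable lebesgue (ivl \<gamma>) f"
    and c: "\<And>s'. s < s' \<Longrightarrow> distr_fn \<gamma> f s' \<le> c"
  shows "distr_fn \<gamma> f s \<le> c"
proof (cases s)
  case top
  then show ?thesis
    by (simp add: distr_fn_def)
next
  case (real r)
  define A where "A n = {x \<in> ivl \<gamma>. ennreal (r + 1 / Suc n) < ennreal \<bar>f x\<bar>}" for n :: nat
  have inc: "incseq A"
  proof (rule incseq_SucI)
    fix n
    have "ennreal (r + 1 / Suc (Suc n)) \<le> ennreal (r + 1 / Suc n)"
      by (intro ennreal_leI) (simp add: frac_le)
    then show "A n \<subseteq> A (Suc n)"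
      unfolding A_def by (auto simp del: ennreal_plus of_nat_Suc intro: le_less_trans)
  qed
  have U: "{x \<in> ivl \<gamma>. s < ennreal \<bar>f x\<bar>} = (\<Union>n. A n)"
    using real less_iff_ex_add_inverse_Suc[of r]
    by (auto simp: A_def ennreal_less_iff simp del: ennreal_plus)
  have Am: "range A \<subseteq> sets lebesgue"
    using distr_fn_set_in_lebesgue[OF meas] by (auto simp: A_def)
  have "distr_fn \<gamma> f s = (SUP n. emeasure lebesgue (A n))"
    unfolding distr_fn_def U by (rule SUP_emeasure_incseq[OF Am inc, symmetric])
  also have "\<dots> \<le> c"
  proof (rule SUP_least)
    fix n
    have "s < ennreal (r + 1 / Suc n)"
      using real by (simp add: ennreal_less_iff)
    then show "emeasure lebesgue (A n) \<le> c"
      using c by (simp add: distr_fn_def A_def)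
  qed
  finally show ?thesis .
qed

lemma rearr_less_iff:
  assumes meas: "set_borel_measurable lebesgue (ivl \<gamma>) f"
  shows "s < rearr \<gamma> f u \<longleftrightarrow> ennreal u < distr_fn \<gamma> f s"
proof -
  have "rearr \<gamma> f u \<le> s \<longleftrightarrow> distr_fn \<gamma> f s \<le> ennreal u"
  proof
    assume "rearr \<gamma> f u \<le> s"
    show "distr_fn \<gamma> f s \<le> ennreal u"
    proof (rule distr_fn_right_continuous[OF meas])
      fix s' assume "s < s'"
      with \<open>rearr \<gamma> f u \<le> s\<close> have "Inf {s. distr_fn \<gamma> f s \<le> ennreal u} < s'"
        by (simp add: rearr_def)
      then obtain s'' where "distr_fn \<gamma> f s'' \<le> ennreal u" "s'' < s'"
        by (auto simp: Inf_less_iff)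
      then show "distr_fn \<gamma> f s' \<le> ennreal u"
        using distr_fn_antimono[OF meas, of s'' s'] by (meson order_trans less_imp_le)
    qed
  qed (auto simp: rearr_def intro: Inf_lower)
  then show ?thesis
    by (meson not_le)
qed

lemma rearr_antimono: "u \<le> u' \<Longrightarrow> rearr \<gamma> f u' \<le> rearr \<gamma> f u"
  unfolding rearr_def by (rule Inf_superset_mono) (auto intro: order_trans ennreal_leI)

lemma borel_measurable_rearr [measurable]: "rearr \<gamma> f \<in> borel_measurable borel"
  by (rule borel_measurable_antimono_ennreal) (rule rearr_antimono)

lemma emeasure_lborel_Ioo_below:
  assumes "0 \<le> t"
  shows "emeasure lborel {u::real. 0 < u \<and> u < t \<and> ennreal u < L} = min (ennreal t) L"
proof (cases L)
  case (real l)
  then have "{u::real. 0 < u \<and> u < t \<and> ennreal u < L} = {0<..<min t l}"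
    by (auto simp: ennreal_less_iff)
  then show ?thesis
    using real assms by (simp add: min_ennreal)
next
  case top
  then have "{u::real. 0 < u \<and> u < t \<and> ennreal u < L} = {0<..<t}"
    by auto
  then show ?thesis
    using top assms by simp
qed

lemma nn_integral_rearr_eq:
  assumes meas: "set_borel_measurable lebesgue (ivl \<gamma>) f" and t: "0 \<le> t"
  shows "(\<integral>\<^sup>+ u\<in>{0<..<t}. rearr \<gamma> f u \<partial>lborel)
       = (\<integral>\<^sup>+ s. indicator {0<..} s * min (ennreal t) (distr_fn \<gamma> f (ennreal s)) \<partial>lborel)"
proof -
  have "(\<integral>\<^sup>+ u\<in>{0<..<t}. rearr \<gamma> f u \<partial>lborel)
     = (\<integral>\<^sup>+ s. indicator {0<..} s * emeasure lborel
          {u\<in>space lborel. ennreal s < rearr \<gamma> f u * indicator {0<..<t} u} \<partial>lborel)"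
    by (rule nn_integral_layer_cake[OF sigma_finite_lborel]) measurable
  also have "\<dots> = (\<integral>\<^sup>+ s. indicator {0<..} s * min (ennreal t) (distr_fn \<gamma> f (ennreal s)) \<partial>lborel)"
  proof (rule nn_integral_cong)
    fix s :: real
    have "0 < s \<Longrightarrow> {u\<in>space lborel. ennreal s < rearr \<gamma> f u * indicator {0<..<t} u}
        = {u. 0 < u \<and> u < t \<and> ennreal u < distr_fn \<gamma> f (ennreal s)}"
      by (auto simp: indicator_def rearr_less_iff[OF meas])
    then show "indicator {0<..} s
          * emeasure lborel {u\<in>space lborel. ennreal s < rearr \<gamma> f u * indicator {0<..<t} u}
        = indicator {0<..} s * min (ennreal t) (distr_fn \<gamma> f (ennreal s))"
      using t by (cases "0 < s") (simp_all add: emeasure_lborel_Ioo_below)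
  qed
  finally show ?thesis .
qed

lemma nn_integral_le_rearr:
  assumes meas: "set_borel_measurable lebesgue (ivl \<gamma>) f"
    and B: "B \<in> sets lebesgue" "B \<subseteq> ivl \<gamma>" "emeasure lebesgue B \<le> ennreal b" and b: "0 \<le> b"
  shows "(\<integral>\<^sup>+ x\<in>B. ennreal \<bar>f x\<bar> \<partial>lebesgue) \<le> (\<integral>\<^sup>+ u\<in>{0<..<b}. rearr \<gamma> f u \<partial>lborel)"
proof -
  let ?g = "\<lambda>x. indicator (ivl \<gamma>) x * f x"
  have "(\<integral>\<^sup>+ x\<in>B. ennreal \<bar>f x\<bar> \<partial>lebesgue) = (\<integral>\<^sup>+ x. ennreal \<bar>?g x\<bar> * indicator B x \<partial>lebesgue)"
    by (rule nn_integral_cong) (use B in \<open>auto simp: indicator_def\<close>)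
  also have "\<dots> = (\<integral>\<^sup>+ s. indicator {0<..} s
      * emeasure lebesgue {x\<in>space lebesgue. ennreal s < ennreal \<bar>?g x\<bar> * indicator B x} \<partial>lborel)"
    by (rule nn_integral_layer_cake[OF sigma_finite_lebesgue])
      (use set_borel_measurable_ivlD[OF meas] B in measurable)
  also have "\<dots> \<le> (\<integral>\<^sup>+ s. indicator {0<..} s * min (ennreal b) (distr_fn \<gamma> f (ennreal s)) \<partial>lborel)"
  proof (rule nn_integral_mono)
    fix s :: real
    let ?S = "{x\<in>space lebesgue. ennreal s < ennreal \<bar>?g x\<bar> * indicator B x}"
    have "emeasure lebesgue ?S \<le> min (ennreal b) (distr_fn \<gamma> f (ennreal s))" if "0 < s"
    proof -
      have sub: "?S \<subseteq> B" "?S \<subseteq> {x \<in> ivl \<gamma>. ennreal s < ennreal \<bar>f x\<bar>}"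
        using that B by (auto simp: indicator_def split: if_splits)
      have "emeasure lebesgue ?S \<le> emeasure lebesgue B"
        by (rule emeasure_mono[OF sub(1) B(1)])
      moreover have "emeasure lebesgue ?S \<le> distr_fn \<gamma> f (ennreal s)"
        unfolding distr_fn_def by (rule emeasure_mono[OF sub(2) distr_fn_set_in_lebesgue[OF meas]])
      ultimately show ?thesis
        using B(3) by simp
    qed
    then show "indicator {0<..} s * emeasure lebesgue ?S
        \<le> indicator {0<..} s * min (ennreal b) (distr_fn \<gamma> f (ennreal s))"
      by (cases "0 < s") simp_all
  qed
  also have "\<dots> = (\<integral>\<^sup>+ u\<in>{0<..<b}. rearr \<gamma> f u \<partial>lborel)"
    by (rule nn_integral_rearr_eq[OF meas b, symmetric])
  finally show ?thesis .
qed

lemma min_suminf_le_suminf_min: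
  fixes a :: "nat \<Rightarrow> ennreal"
  shows "min t (\<Sum>k. a k) \<le> (\<Sum>k. min t (a k))"
proof (cases "\<exists>k. t \<le> a k")
  case True
  then obtain k where "t \<le> a k"
    by auto
  then have "min t (\<Sum>k. a k) \<le> (\<Sum>i\<in>{k}. min t (a i))"
    by simp
  also have "\<dots> \<le> (\<Sum>k. min t (a k))"
    by (rule sum_le_suminf) auto
  finally show ?thesis .
next
  case False
  then have "min t (a k) = a k" for k
    by (auto simp: not_le intro: less_imp_le)
  then show ?thesis
    by simp
qed

text \<open>The bound on the distribution function of \<open>h\<close> is the distribution function of a sum of
  blocks of height \<open>v k\<close> on sets of measure \<open>e k\<close>.\<close>

lemma nn_integral_rearr_le_suminf:
  fixes v :: "nat \<Rightarrow> real" and e :: "nat \<Rightarrow> ennreal"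
  assumes meas: "set_borel_measurable lebesgue (ivl \<gamma>) h"
    and v: "\<And>k. 0 \<le> v k"
    and distr: "\<And>s. 0 < s \<Longrightarrow> distr_fn \<gamma> h (ennreal s) \<le> (\<Sum>k. indicator {..<v k} s * e k)"
    and t: "0 \<le> t"
  shows "(\<integral>\<^sup>+ u\<in>{0<..<t}. rearr \<gamma> h u \<partial>lborel) \<le> (\<Sum>k. ennreal (v k) * min (ennreal t) (e k))"
proof -
  have "(\<integral>\<^sup>+ u\<in>{0<..<t}. rearr \<gamma> h u \<partial>lborel)
       = (\<integral>\<^sup>+ s. indicator {0<..} s * min (ennreal t) (distr_fn \<gamma> h (ennreal s)) \<partial>lborel)"
    by (rule nn_integral_rearr_eq[OF meas t])
  also have "\<dots> \<le> (\<integral>\<^sup>+ s. (\<Sum>k. indicator {0<..<v k} s * min (ennreal t) (e k)) \<partial>lborel)"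
  proof (rule nn_integral_mono)
    fix s :: real
    have "min (ennreal t) (distr_fn \<gamma> h (ennreal s))
        \<le> (\<Sum>k. indicator {0<..<v k} s * min (ennreal t) (e k))" if s: "0 < s"
    proof -
      have "min (ennreal t) (distr_fn \<gamma> h (ennreal s))
          \<le> min (ennreal t) (\<Sum>k. indicator {..<v k} s * e k)"
        using distr[OF s] by (rule min.mono[OF order_refl])
      also have "\<dots> \<le> (\<Sum>k. min (ennreal t) (indicator {..<v k} s * e k))"
        by (rule min_suminf_le_suminf_min)
      also have "\<dots> = (\<Sum>k. indicator {0<..<v k} s * min (ennreal t) (e k))"
        using s by (intro suminf_cong) (auto simp: indicator_def)
      finally show ?thesis .
    qed
    then show "indicator {0<..} s * min (ennreal t) (distr_fn \<gamma> h (ennreal s))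
        \<le> (\<Sum>k. indicator {0<..<v k} s * min (ennreal t) (e k))"
      by (cases "0 < s") simp_all
  qed
  also have "\<dots> = (\<Sum>k. (\<integral>\<^sup>+ s. min (ennreal t) (e k) * indicator {0<..<v k} s \<partial>lborel))"
    by (subst nn_integral_suminf) (simp_all add: mult.commute)
  also have "\<dots> = (\<Sum>k. ennreal (v k) * min (ennreal t) (e k))"
    using v by (simp add: nn_integral_cmult_indicator mult.commute)
  finally show ?thesis .
qed

definition step_fn :: "(nat \<Rightarrow> real set) \<Rightarrow> (nat \<Rightarrow> real) \<Rightarrow> real \<Rightarrow> real" where
  "step_fn E v x = (\<Sum>k. v k * indicator (E k) x)"

lemma step_fn_eq:
  assumes "disjoint_family E" "x \<in> E k"
  shows "step_fn E v x = v k"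
proof -
  have "step_fn E v x = (\<Sum>i\<in>{k}. v i * indicator (E i) x)"
    unfolding step_fn_def
  proof (rule suminf_finite)
    fix i
    assume "i \<notin> {k}"
    then have "x \<notin> E i"
      using assms by (auto simp: disjoint_family_on_def)
    then show "v i * indicator (E i) x = 0"
      by simp
  qed simp
  then show ?thesis
    using assms by simp
qed

lemma step_fn_outside: "(\<And>k. x \<notin> E k) \<Longrightarrow> step_fn E v x = 0"
  by (simp add: step_fn_def)

lemma step_fn_nonneg:
  assumes "disjoint_family E" "\<And>k. 0 \<le> v k"
  shows "0 \<le> step_fn E v x"
  using assms step_fn_eq[OF assms(1)] step_fn_outside by (cases "\<exists>k. x \<in> E k") auto

lemma set_borel_measurable_step_fn:
  assumes "\<And>k. E k \<in> sets borel"
  shows "set_borel_measurable lebesgue (ivl \<gamma>) (step_fn E v)"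
proof -
  have "(\<lambda>x. indicator (ivl \<gamma>) x *\<^sub>R step_fn E v x) \<in> borel_measurable borel"
    unfolding step_fn_def using assms by measurable
  then show ?thesis
    by (simp add: set_borel_measurable_def measurable_completion)
qed

lemma nn_integral_rearr_step_fn_le:
  assumes E: "\<And>k. E k \<in> sets borel" "disjoint_family E"
    and e: "\<And>k. emeasure lebesgue (E k) \<le> ennreal (e k)"
    and v: "\<And>k. 0 \<le> v k" and t: "0 \<le> t"
  shows "(\<integral>\<^sup>+ u\<in>{0<..<t}. rearr \<gamma> (step_fn E v) u \<partial>lborel)
    \<le> (\<Sum>k. ennreal (v k) * min (ennreal t) (ennreal (e k)))"
proof (rule nn_integral_rearr_le_suminf[OF set_borel_measurable_step_fn[OF E(1)] v _ t])
  fix s :: real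
  assume s: "0 < s"
  define F where "F k = (if s < v k then E k else {})" for k
  have "{x \<in> ivl \<gamma>. ennreal s < ennreal \<bar>step_fn E v x\<bar>} \<subseteq> (\<Union>k. F k)"
  proof
    fix x
    assume "x \<in> {x \<in> ivl \<gamma>. ennreal s < ennreal \<bar>step_fn E v x\<bar>}"
    then have x: "s < \<bar>step_fn E v x\<bar>"
      using s by (simp add: ennreal_less_iff)
    then obtain k where k: "x \<in> E k"
      using step_fn_outside s by force
    then show "x \<in> (\<Union>k. F k)"
      using x step_fn_eq[OF E(2) k] v[of k] by (auto simp: F_def)
  qed
  moreover have F: "range F \<subseteq> sets lebesgue"
    using E(1) by (auto simp: F_def)
  ultimately have "distr_fn \<gamma> (step_fn E v) (ennreal s) \<le> emeasure lebesgue (\<Union>k. F k)"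
    unfolding distr_fn_def by (intro emeasure_mono) auto
  also have "\<dots> \<le> (\<Sum>k. emeasure lebesgue (F k))"
    by (rule emeasure_subadditive_countably[OF F])
  also have "\<dots> \<le> (\<Sum>k. indicator {..<v k} s * ennreal (e k))"
    using e by (intro suminf_le) (auto simp: F_def indicator_def)
  finally show "distr_fn \<gamma> (step_fn E v) (ennreal s) \<le> (\<Sum>k. indicator {..<v k} s * ennreal (e k))" .
qed

section \<open>Series of positive functionals\<close>

lemma M_norm_abs [simp]: "M_norm \<gamma> \<psi> (\<lambda>x. \<bar>f x\<bar>) = M_norm \<gamma> \<psi> f"
  by (simp add: M_norm_def rearr_def distr_fn_def)

lemma M_space_abs:
  assumes "f \<in> M_space \<gamma> \<psi>"
  shows "(\<lambda>x. \<bar>f x\<bar>) \<in> M_space \<gamma> \<psi>"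
proof -
  have "(\<lambda>x. indicator (ivl \<gamma>) x * f x) \<in> borel_measurable lebesgue"
    using assms by (simp add: M_space_def set_borel_measurable_def)
  then have "(\<lambda>x. \<bar>indicator (ivl \<gamma>) x * f x\<bar>) \<in> borel_measurable lebesgue"
    by measurable
  moreover have "(\<lambda>x. \<bar>indicator (ivl \<gamma>) x * f x\<bar>) = (\<lambda>x. indicator (ivl \<gamma>) x * \<bar>f x\<bar>)"
    by (auto simp: indicator_def)
  ultimately show ?thesis
    using assms by (simp add: M_space_def set_borel_measurable_def)
qed

lemma M_rnorm_nonneg: "0 \<le> M_rnorm \<gamma> \<psi> f"
  by (simp add: M_rnorm_def)

lemma abs_le_dual_norm:
  assumes F: "F \<in> M_dual \<gamma> \<psi>" and h: "h \<in> M_space \<gamma> \<psi>" "M_rnorm \<gamma> \<psi> h \<le> 1"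
  shows "\<bar>F h\<bar> \<le> dual_norm \<gamma> \<psi> F"
proof -
  obtain C where C: "\<And>f. f \<in> M_space \<gamma> \<psi> \<Longrightarrow> \<bar>F f\<bar> \<le> C * M_rnorm \<gamma> \<psi> f"
    using F unfolding M_dual_def by blast
  have "\<bar>F f\<bar> \<le> max C 0" if "f \<in> M_space \<gamma> \<psi>" "M_rnorm \<gamma> \<psi> f \<le> 1" for f
  proof -
    have "\<bar>F f\<bar> \<le> max C 0 * M_rnorm \<gamma> \<psi> f"
      using C[OF that(1)] mult_right_mono[OF max.cobounded1 M_rnorm_nonneg] by (rule order_trans)
    also have "\<dots> \<le> max C 0"
      using that(2) by (simp add: mult_left_le)
    finally show ?thesis .
  qed
  then have "bdd_above {\<bar>F f\<bar> | f. f \<in> M_space \<gamma> \<psi> \<and> M_rnorm \<gamma> \<psi> f \<le> 1}"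
    by (auto intro!: bdd_aboveI)
  then show ?thesis
    unfolding dual_norm_def by (rule cSup_upper[rotated]) (use h in auto)
qed

text \<open>The tails \<open>\<Sum>\<^sub>j\<^sub>\<ge>\<^sub>n \<Psi>\<^sub>j\<close> of such a series decrease to \<open>0\<close> in the dual lattice; if their
  norms stay away from \<open>0\<close>, the dual norm is not order continuous.\<close>

locale positive_functional_series =
  fixes \<gamma> :: ereal and \<psi> :: "real \<Rightarrow> real" and C :: real
    and \<Psi> :: "nat \<Rightarrow> (real \<Rightarrow> real) \<Rightarrow> real"
  assumes add: "\<And>j f g. f \<in> M_space \<gamma> \<psi> \<Longrightarrow> g \<in> M_space \<gamma> \<psi>
      \<Longrightarrow> \<Psi> j (\<lambda>x. f x + g x) = \<Psi> j f + \<Psi> j g"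
    and mult: "\<And>j f c. f \<in> M_space \<gamma> \<psi> \<Longrightarrow> \<Psi> j (\<lambda>x. c * f x) = c * \<Psi> j f"
    and nonneg: "\<And>j f. f \<in> M_space \<gamma> \<psi> \<Longrightarrow> (AE x in lebesgue. x \<in> ivl \<gamma> \<longrightarrow> 0 \<le> f x)
      \<Longrightarrow> 0 \<le> \<Psi> j f"
    and abs_le: "\<And>j f. f \<in> M_space \<gamma> \<psi> \<Longrightarrow> \<bar>\<Psi> j f\<bar> \<le> \<Psi> j (\<lambda>x. \<bar>f x\<bar>)"
    and partial_sums_le: "\<And>N f. f \<in> M_space \<gamma> \<psi>
      \<Longrightarrow> (\<Sum>j<N. \<Psi> j (\<lambda>x. \<bar>f x\<bar>)) \<le> C * M_rnorm \<gamma> \<psi> f"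
begin

lemma nonneg_abs: "f \<in> M_space \<gamma> \<psi> \<Longrightarrow> 0 \<le> \<Psi> j (\<lambda>x. \<bar>f x\<bar>)"
  using nonneg[OF M_space_abs] by simp

lemma abs_le_norm:
  assumes f: "f \<in> M_space \<gamma> \<psi>"
  shows "\<bar>\<Psi> j f\<bar> \<le> C * M_rnorm \<gamma> \<psi> f"
proof -
  have "\<bar>\<Psi> j f\<bar> \<le> \<Psi> j (\<lambda>x. \<bar>f x\<bar>)"
    by (rule abs_le[OF f])
  also have "\<dots> \<le> (\<Sum>i<Suc j. \<Psi> i (\<lambda>x. \<bar>f x\<bar>))"
    using nonneg_abs[OF f] by (simp add: sum_nonneg)
  also have "\<dots> \<le> C * M_rnorm \<gamma> \<psi> f"
    by (rule partial_sums_le[OF f])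
  finally show ?thesis .
qed

lemma summable_abs: "f \<in> M_space \<gamma> \<psi> \<Longrightarrow> summable (\<lambda>j. \<Psi> j (\<lambda>x. \<bar>f x\<bar>))"
  by (rule summableI_nonneg_bounded[where x="C * M_rnorm \<gamma> \<psi> f"])
    (use nonneg_abs partial_sums_le in auto)

lemma summable_shifted: "f \<in> M_space \<gamma> \<psi> \<Longrightarrow> summable (\<lambda>j. \<Psi> (j + n) f)"
  by (rule summable_ignore_initial_segment, rule summable_comparison_test'[OF summable_abs])
    (use abs_le in auto)

definition tail :: "nat \<Rightarrow> (real \<Rightarrow> real) \<Rightarrow> real" where
  "tail n f = (\<Sum>j. \<Psi> (j + n) f)"

lemma tail_split:
  assumes f: "f \<in> M_space \<gamma> \<psi>"
  shows "tail n f = (\<Sum>i<k. \<Psi> (i + n) f) + tail (k + n) f"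
  unfolding tail_def
  by (subst suminf_split_initial_segment[OF summable_shifted[OF f], of n k]) (simp add: ac_simps)

lemma tail_abs_le:
  assumes f: "f \<in> M_space \<gamma> \<psi>"
  shows "\<bar>tail n f\<bar> \<le> C * M_rnorm \<gamma> \<psi> f"
proof -
  have s: "summable (\<lambda>j. \<Psi> (j + n) (\<lambda>x. \<bar>f x\<bar>))"
    using summable_ignore_initial_segment[OF summable_abs[OF f]] .
  have "\<bar>tail n f\<bar> \<le> (\<Sum>j. \<Psi> (j + n) (\<lambda>x. \<bar>f x\<bar>))"
    unfolding tail_def
    by (rule order_trans[OF summable_rabs])
      (auto intro!: suminf_le summable_rabs_comparison_test[OF _ s] s abs_le f)
  also have "\<dots> \<le> (\<Sum>j. \<Psi> j (\<lambda>x. \<bar>f x\<bar>))"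
    using suminf_split_initial_segment[OF summable_abs[OF f], of n] nonneg_abs[OF f]
    by (simp add: sum_nonneg)
  also have "\<dots> \<le> C * M_rnorm \<gamma> \<psi> f"
    by (rule suminf_le_const[OF summable_abs[OF f]]) (use partial_sums_le f in auto)
  finally show ?thesis .
qed

lemma tail_in_M_dual: "tail n \<in> M_dual \<gamma> \<psi>"
  unfolding M_dual_def
proof (intro CollectI conjI ballI allI exI)
  fix f g
  assume f: "f \<in> M_space \<gamma> \<psi>" and g: "g \<in> M_space \<gamma> \<psi>"
  show "tail n (\<lambda>x. f x + g x) = tail n f + tail n g"
    unfolding tail_def using add[OF f g] by (simp add: suminf_add[OF summable_shifted[OF f] summable_shifted[OF g]])
next
  fix f and c :: real
  assume f: "f \<in> M_space \<gamma> \<psi>"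
  show "tail n (\<lambda>x. c * f x) = c * tail n f"
    unfolding tail_def using mult[OF f] by (simp add: suminf_mult[OF summable_shifted[OF f]])
next
  fix f
  assume "f \<in> M_space \<gamma> \<psi>"
  then show "\<bar>tail n f\<bar> \<le> C * M_rnorm \<gamma> \<psi> f"
    by (rule tail_abs_le)
qed

lemma tail_nonneg:
  assumes "f \<in> M_space \<gamma> \<psi>" "AE x in lebesgue. x \<in> ivl \<gamma> \<longrightarrow> 0 \<le> f x"
  shows "0 \<le> tail n f"
  unfolding tail_def using assms by (intro suminf_nonneg summable_shifted nonneg)

lemma tail_antimono: "n \<le> m \<Longrightarrow> dual_le \<gamma> \<psi> (tail m) (tail n)"
  unfolding dual_le_def
proof (intro ballI impI)
  fix f
  assume "n \<le> m" and f: "f \<in> M_space \<gamma> \<psi>"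
    and pos: "AE x in lebesgue. x \<in> ivl \<gamma> \<longrightarrow> 0 \<le> f x"
  have "tail n f = (\<Sum>i<m - n. \<Psi> (i + n) f) + tail (m - n + n) f"
    by (rule tail_split[OF f])
  moreover have "0 \<le> (\<Sum>i<m - n. \<Psi> (i + n) f)"
    by (intro sum_nonneg nonneg f pos)
  ultimately show "tail m f \<le> tail n f"
    using \<open>n \<le> m\<close> by simp
qed

lemma tail_tendsto_zero: "f \<in> M_space \<gamma> \<psi> \<Longrightarrow> (\<lambda>n. tail n f) \<longlonglongrightarrow> 0"
  unfolding tail_def
  using suminf_exist_split[OF _ summable_shifted[of f 0]] by (auto intro!: LIMSEQ_I)

lemma INF_dual_norm_tail:
  assumes "dual_order_continuous \<gamma> \<psi>"
  shows "(INF n. dual_norm \<gamma> \<psi> (tail n)) = 0"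
proof -
  have "(INF F\<in>range tail. dual_norm \<gamma> \<psi> F) = 0"
  proof (rule assms[unfolded dual_order_continuous_def, rule_format], intro conjI ballI impI)
    show "range tail \<subseteq> M_dual \<gamma> \<psi>" "range tail \<noteq> {}"
      using tail_in_M_dual by auto
  next
    fix F G
    assume "F \<in> range tail" "G \<in> range tail"
    then obtain n m where "F = tail n" "G = tail m"
      by auto
    then show "\<exists>H\<in>range tail. dual_le \<gamma> \<psi> H F \<and> dual_le \<gamma> \<psi> H G"
      by (intro bexI[of _ "tail (max n m)"]) (auto intro!: tail_antimono)
  next
    fix F
    assume "F \<in> range tail"
    then show "dual_le \<gamma> \<psi> (\<lambda>f. 0) F"
      unfolding dual_le_def using tail_nonneg by auto
  next
    fix H
    assume lower: "\<forall>F\<in>range tail. dual_le \<gamma> \<psi> H F"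
    show "dual_le \<gamma> \<psi> H (\<lambda>f. 0)"
      unfolding dual_le_def
    proof (intro ballI impI)
      fix f
      assume "f \<in> M_space \<gamma> \<psi>" "AE x in lebesgue. x \<in> ivl \<gamma> \<longrightarrow> 0 \<le> f x"
      then have "\<forall>n. H f \<le> tail n f"
        using lower by (auto simp: dual_le_def)
      then show "H f \<le> 0"
        using tail_tendsto_zero[OF \<open>f \<in> M_space \<gamma> \<psi>\<close>] by (intro LIMSEQ_le_const) auto
    qed
  qed
  then show ?thesis
    by (simp add: image_image)
qed

theorem not_dual_order_continuous:
  assumes h: "\<And>j. h j \<in> M_space \<gamma> \<psi>" "\<And>j. M_rnorm \<gamma> \<psi> (h j) \<le> 1" "\<And>j x. 0 \<le> h j x"
    and c: "0 < c" "\<And>j. c \<le> \<Psi> j (h j)"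
  shows "\<not> dual_order_continuous \<gamma> \<psi>"
proof
  assume "dual_order_continuous \<gamma> \<psi>"
  moreover have "c \<le> dual_norm \<gamma> \<psi> (tail n)" for n
  proof -
    have "c \<le> \<Psi> n (h n)"
      by (rule c(2))
    also have "\<dots> \<le> tail n (h n)"
      using tail_split[OF h(1)[of n], of n 1] tail_nonneg[OF h(1)] h(3) by simp
    also have "\<dots> \<le> dual_norm \<gamma> \<psi> (tail n)"
      using abs_le_dual_norm[OF tail_in_M_dual h(1,2), of n n] by simp
    finally show ?thesis .
  qed
  then have "c \<le> (INF n. dual_norm \<gamma> \<psi> (tail n))"
    by (rule cINF_greatest[rotated]) simp
  ultimately show False
    using c(1) INF_dual_norm_tail by simp
qed

end

lemma positive_functional_series_Lim:
  assumes U: "ultrafilter U" and \<phi>: "\<And>k. positive_functional_series \<gamma> \<psi> C (\<phi> k)"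
  shows "positive_functional_series \<gamma> \<psi> C (\<lambda>j f. Lim U (\<lambda>k. \<phi> k j f))"
proof -
  note U' = ultrafilter_not_bot[OF U]
  have lim: "((\<lambda>k. \<phi> k j f) \<longlongrightarrow> Lim U (\<lambda>k. \<phi> k j f)) U" if "f \<in> M_space \<gamma> \<psi>" for j f
    by (rule ultrafilter_tendsto_Lim[OF U])
      (rule positive_functional_series.abs_le_norm[OF \<phi> that])
  have Lim_eq: "Lim U x = l" if "(x \<longlongrightarrow> l) U" for x and l :: real
    using tendsto_Lim[OF U' that] .
  show ?thesis
  proof
    fix j f g
    assume "f \<in> M_space \<gamma> \<psi>" "g \<in> M_space \<gamma> \<psi>"
    then show "Lim U (\<lambda>k. \<phi> k j (\<lambda>x. f x + g x)) = Lim U (\<lambda>k. \<phi> k j f) + Lim U (\<lambda>k. \<phi> k j g)"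
      using positive_functional_series.add[OF \<phi>] by (simp add: Lim_eq tendsto_add lim)
  next
    fix j f c
    assume "f \<in> M_space \<gamma> \<psi>"
    then show "Lim U (\<lambda>k. \<phi> k j (\<lambda>x. c * f x)) = c * Lim U (\<lambda>k. \<phi> k j f)"
      using positive_functional_series.mult[OF \<phi>] by (simp add: Lim_eq tendsto_mult_left lim)
  next
    fix j f
    assume "f \<in> M_space \<gamma> \<psi>" "AE x in lebesgue. x \<in> ivl \<gamma> \<longrightarrow> 0 \<le> f x"
    then show "0 \<le> Lim U (\<lambda>k. \<phi> k j f)"
      using positive_functional_series.nonneg[OF \<phi>]
      by (intro tendsto_lowerbound[OF lim _ U']) (auto intro: always_eventually)
  next
    fix j f
    assume f: "f \<in> M_space \<gamma> \<psi>"
    show "\<bar>Lim U (\<lambda>k. \<phi> k j f)\<bar> \<le> Lim U (\<lambda>k. \<phi> k j (\<lambda>x. \<bar>f x\<bar>))"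
      using positive_functional_series.abs_le[OF \<phi> f]
      by (intro tendsto_le[OF U' lim tendsto_rabs[OF lim]] M_space_abs f always_eventually) auto
  next
    fix N f
    assume f: "f \<in> M_space \<gamma> \<psi>"
    show "(\<Sum>j<N. Lim U (\<lambda>k. \<phi> k j (\<lambda>x. \<bar>f x\<bar>))) \<le> C * M_rnorm \<gamma> \<psi> f"
      using positive_functional_series.partial_sums_le[OF \<phi> f]
      by (intro tendsto_upperbound[OF tendsto_sum[OF lim] _ U'] M_space_abs f always_eventually)
        auto
  qed
qed

lemma disjoint_family_Ioo_ascending:
  fixes a b :: "nat \<Rightarrow> real"
  assumes "\<And>k. a k \<le> b k" "\<And>k. b k \<le> a (Suc k)"
  shows "disjoint_family (\<lambda>k. {a k<..<b k})"
proof -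
  have "incseq a"
    using assms by (intro incseq_SucI) (rule order_trans)
  then have "{a i<..<b i} \<inter> {a j<..<b j} = {}" if "i < j" for i j
    using incseqD[of a "Suc i" j] assms(2)[of i] that by auto
  then show ?thesis
    unfolding disjoint_family_on_def by (metis Int_commute linorder_neqE_nat)
qed

lemma disjoint_family_Ioo_descending:
  fixes a b :: "nat \<Rightarrow> real"
  assumes "\<And>k. a k \<le> b k" "\<And>k. b (Suc k) \<le> a k"
  shows "disjoint_family (\<lambda>k. {a k<..<b k})"
proof -
  have "decseq b"
    using assms by (intro decseq_SucI) (rule order_trans)
  then have "{a i<..<b i} \<inter> {a j<..<b j} = {}" if "i < j" for i j
    using decseqD[of b "Suc i" j] assms(2)[of i] that by auto
  then show ?thesis
    unfolding disjoint_family_on_def by (metis Int_commute linorder_neqE_nat)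
qed

lemma geometric_decay_forward:
  fixes x :: "nat \<Rightarrow> real"
  assumes halve: "\<And>k. x (Suc k) \<le> x k / 2" and "m \<le> k"
  shows "x k \<le> (1/2) ^ (k - m) * x m"
  using \<open>m \<le> k\<close>
proof (induction k rule: dec_induct)
  case (step k)
  then have "x (Suc k) \<le> (1/2) ^ (k - m) * x m / 2"
    using halve[of k] by simp
  also have "\<dots> = (1/2) ^ (Suc k - m) * x m"
    using step.hyps by (simp add: Suc_diff_le)
  finally show ?case .
qed simp

lemma geometric_decay_backward:
  fixes x :: "nat \<Rightarrow> real"
  assumes halve: "\<And>k. x k \<le> x (Suc k) / 2" and "k < m"
  shows "x k \<le> (1/2) ^ (m - 1 - k) * x (m - 1)"
proof -
  have "x (m - 1 - d) \<le> (1/2) ^ d * x (m - 1)" if "d \<le> m - 1" for d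
    using that
  proof (induction d)
    case (Suc d)
    then have "Suc (m - 1 - Suc d) = m - 1 - d"
      by simp
    then have "x (m - 1 - Suc d) \<le> x (m - 1 - d) / 2"
      using halve[of "m - 1 - Suc d"] by simp
    with Suc show ?case
      by simp
  qed simp
  from this[of "m - 1 - k"] show ?thesis
    using \<open>k < m\<close> by simp
qed

lemma ex_le_if_halving:
  fixes t :: "nat \<Rightarrow> real"
  assumes halve: "\<And>k. t (Suc k) \<le> t k / 2" and "0 < \<tau>"
  shows "\<exists>k. t k \<le> \<tau>"
proof (cases "t 0 \<le> 0")
  case True
  with \<open>0 < \<tau>\<close> show ?thesis
    by (intro exI[of _ 0]) simp
next
  case False
  obtain n where "(1/2) ^ n < \<tau> / t 0"
    using real_arch_pow_inv[of "\<tau> / t 0" "1/2"] \<open>0 < \<tau>\<close> False by auto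
  then have "(1/2) ^ n * t 0 < \<tau>"
    using False by (simp add: pos_less_divide_eq)
  moreover have "t n \<le> (1/2) ^ n * t 0"
    using geometric_decay_forward[of t 0 n, OF halve] by simp
  ultimately show ?thesis
    by (meson less_imp_le order_trans)
qed

lemma ex_gt_if_doubling:
  fixes t :: "nat \<Rightarrow> real"
  assumes double: "\<And>k. 2 * t k \<le> t (Suc k)" and "0 < t 0"
  shows "\<exists>k. \<tau> < t k"
proof -
  have "2 ^ k * t 0 \<le> t k" for k
  proof (induction k)
    case (Suc k)
    then show ?case
      using double[of k] by simp
  qed simp
  moreover obtain n where "\<tau> / t 0 < 2 ^ n"
    using real_arch_pow[of 2 "\<tau> / t 0"] by auto
  then have "\<tau> < 2 ^ n * t 0"
    using \<open>0 < t 0\<close> by (simp add: pos_divide_less_eq)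
  ultimately show ?thesis
    by (meson less_le_trans)
qed

lemma suminf_le_two_sided_geometric:
  fixes a :: "nat \<Rightarrow> ennreal" and B :: real
  assumes B: "0 \<le> B"
    and up: "\<And>k. m \<le> k \<Longrightarrow> a k \<le> ennreal (B * (1/2) ^ (k - m))"
    and down: "\<And>k. k < m \<Longrightarrow> a k \<le> ennreal (B * (1/2) ^ (m - 1 - k))"
  shows "(\<Sum>k. a k) \<le> ennreal (4 * B)"
proof -
  define g where "g k = (if m \<le> k then B * (1/2) ^ (k - m) else 0)" for k
  define b where "b k = (if k < m then B * (1/2) ^ (m - 1 - k) else 0)" for k
  have g: "g sums (2 * B)"
  proof -
    have "(\<lambda>i. B * (1/2::real) ^ i) sums (B * (1 / (1 - 1/2)))"
      by (intro sums_mult geometric_sums) simp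
    then have "(\<lambda>i. g (i + m)) sums (2 * B)"
      by (simp add: g_def mult.commute)
    then have "g sums (2 * B + (\<Sum>i<m. g i))"
      by (simp only: sums_iff_shift)
    moreover have "(\<Sum>i<m. g i) = 0"
      by (simp add: g_def)
    ultimately show ?thesis
      by simp
  qed
  have "(\<Sum>k<m. b k) \<le> 2 * B"
  proof -
    have "(\<Sum>k<m. b k) = (\<Sum>k<m. B * (1/2) ^ (m - Suc k))"
      by (simp add: b_def)
    also have "\<dots> = (\<Sum>k<m. B * (1/2) ^ k)"
      by (rule sum.nat_diff_reindex)
    also have "\<dots> \<le> (\<Sum>k. B * (1/2) ^ k)"
      using B by (intro sum_le_suminf summable_mult summable_geometric) auto
    also have "\<dots> = 2 * B"
      by (simp add: suminf_mult summable_geometric suminf_geometric)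
    finally show ?thesis .
  qed
  moreover have "b sums (\<Sum>k<m. b k)"
    by (rule sums_finite) (auto simp: b_def)
  ultimately have b: "b sums (\<Sum>k<m. b k)" "(\<Sum>k<m. b k) \<le> 2 * B"
    by simp_all
  have nonneg: "0 \<le> g k" "0 \<le> b k" for k
    using B by (simp_all add: g_def b_def)
  have "(\<Sum>k. a k) \<le> (\<Sum>k. ennreal (g k + b k))"
    using up down nonneg by (intro suminf_le) (auto simp: g_def b_def)
  also have "\<dots> = ennreal (\<Sum>k. g k + b k)"
    using nonneg sums_add[OF g b(1)] by (intro suminf_ennreal2) (simp_all add: sums_iff)
  also have "\<dots> \<le> ennreal (4 * B)"
    using sums_add[OF g b(1)] b(2) by (intro ennreal_leI) (simp add: sums_iff)
  finally show ?thesis .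
qed

lemma suminf_min_le_geometric:
  fixes a p q :: "nat \<Rightarrow> real"
  assumes a: "\<And>k. 0 \<le> a k" "\<And>k. a k \<le> p k" "\<And>k. a k \<le> q k"
    and p: "\<And>k. p (Suc k) \<le> p k / 2" and q: "\<And>k. q k \<le> q (Suc k) / 2"
    and B: "p m \<le> B" "0 < m \<Longrightarrow> q (m - 1) \<le> B"
  shows "(\<Sum>k. ennreal (a k)) \<le> ennreal (4 * B)"
proof (rule suminf_le_two_sided_geometric)
  show "0 \<le> B"
    using a(1,2)[of m] B(1) by linarith
  show "ennreal (a k) \<le> ennreal (B * (1/2) ^ (k - m))" if "m \<le> k" for k
  proof (rule ennreal_leI)
    have "a k \<le> (1/2) ^ (k - m) * p m"
      using a(2)[of k] geometric_decay_forward[of p, OF p that] by linarith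
    also have "\<dots> \<le> (1/2) ^ (k - m) * B"
      using B(1) by (intro mult_left_mono) simp_all
    finally show "a k \<le> B * (1/2) ^ (k - m)"
      by (simp add: mult.commute)
  qed
  show "ennreal (a k) \<le> ennreal (B * (1/2) ^ (m - 1 - k))" if "k < m" for k
  proof (rule ennreal_leI)
    have "a k \<le> (1/2) ^ (m - 1 - k) * q (m - 1)"
      using a(3)[of k] geometric_decay_backward[of q, OF q that] by linarith
    also have "\<dots> \<le> (1/2) ^ (m - 1 - k) * B"
      using B(2) that by (intro mult_left_mono) simp_all
    finally show "a k \<le> B * (1/2) ^ (m - 1 - k)"
      by (simp add: mult.commute)
  qed
qed

lemma frequently_less_if_not_Liminf_greater:
  fixes f :: "'a \<Rightarrow> real"
  assumes L: "\<not> ereal c < Liminf F (\<lambda>x. ereal (f x))" and "0 < \<epsilon>"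
  shows "\<exists>\<^sub>F x in F. f x < c + \<epsilon>"
proof (rule ccontr)
  assume "\<not> (\<exists>\<^sub>F x in F. f x < c + \<epsilon>)"
  then have ev: "eventually (\<lambda>x. c + \<epsilon> \<le> f x) F"
    by (simp add: not_frequently not_less)
  have "ereal (c + \<epsilon>) \<le> Liminf F (\<lambda>x. ereal (f x))"
    unfolding le_Liminf_iff
  proof (intro allI impI)
    fix y
    assume "y < ereal (c + \<epsilon>)"
    with ev show "eventually (\<lambda>x. y < ereal (f x)) F"
      by (elim eventually_mono) (auto intro: less_le_trans)
  qed
  moreover have "ereal c < ereal (c + \<epsilon>)"
    using \<open>0 < \<epsilon>\<close> by simp
  ultimately show False
    using L less_le_trans by blast
qed

lemma min_one_bounds:
  fixes x t \<tau> :: real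
  assumes "0 \<le> x" "0 < t" "0 < \<tau>"
  shows "0 \<le> x * min 1 (\<tau> / t)" "x * min 1 (\<tau> / t) \<le> x" "x * min 1 (\<tau> / t) \<le> \<tau> * (x / t)"
  using assms by (auto simp: min_def mult_left_le field_simps mult_right_mono)

text \<open>\<open>cell s m j\<close> is the \<open>j\<close>-th of the intervals \<open>(s,2s), \<dots>, ((m - 1)s, ms)\<close>, counted from \<open>0\<close>.\<close>

definition cell :: "real \<Rightarrow> nat \<Rightarrow> nat \<Rightarrow> real set" where
  "cell s m j = (if Suc j < m then {real (Suc j) * s<..<real (Suc (Suc j)) * s} else {})"

lemma cell_in_borel [measurable]: "cell s m j \<in> sets borel"
  by (simp add: cell_def)

lemma cell_subset:
  assumes "0 < s"
  shows "cell s m j \<subseteq> {s<..<real m * s}"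
proof -
  have "real (Suc (Suc j)) * s \<le> real m * s" if "Suc j < m"
    using that assms by (intro mult_right_mono) auto
  moreover have "s \<le> real (Suc j) * s"
    using assms by simp
  ultimately show ?thesis
    by (auto simp: cell_def)
qed

lemma disjoint_family_cell:
  assumes "0 < s"
  shows "disjoint_family (cell s m)"
  unfolding disjoint_family_on_def
proof (intro ballI impI)
  fix i j :: nat
  assume "i \<noteq> j"
  have "disjoint_family (\<lambda>j. {real j * s<..<real (Suc j) * s})"
    using assms by (intro disjoint_family_Ioo_ascending) simp_all
  then have "{real (Suc i) * s<..<real (Suc (Suc i)) * s}
      \<inter> {real (Suc j) * s<..<real (Suc (Suc j)) * s} = {}"
    using \<open>i \<noteq> j\<close> unfolding disjoint_family_on_def by blast
  then show "cell s m i \<inter> cell s m j = {}"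
    by (auto simp: cell_def)
qed

lemma emeasure_cell_le:
  assumes "0 < s"
  shows "emeasure lebesgue (cell s m j) \<le> ennreal s"
  using assms by (simp add: cell_def algebra_simps)

lemma disjoint_family_cells:
  fixes t :: "'a \<Rightarrow> real" and m :: "'a \<Rightarrow> nat"
  assumes t: "\<And>k. 0 < t k" and disj: "disjoint_family (\<lambda>k. {t k<..<real (m k) * t k})"
  shows "disjoint_family (\<lambda>k. cell (t k) (m k) n)"
  unfolding disjoint_family_on_def
proof (intro ballI impI)
  fix k k' :: 'a
  assume "k \<noteq> k'"
  have "cell (t k) (m k) n \<inter> cell (t k') (m k') n
      \<subseteq> {t k<..<real (m k) * t k} \<inter> {t k'<..<real (m k') * t k'}"
    by (intro Int_mono cell_subset t)
  with disj \<open>k \<noteq> k'\<close> show "cell (t k) (m k) n \<inter> cell (t k') (m k') n = {}"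
    by (auto simp: disjoint_family_on_def)
qed

section \<open>Concave weights\<close>

locale concave_weight =
  fixes \<gamma> :: ereal and \<psi> :: "real \<Rightarrow> real"
  assumes gamma_pos: "0 < \<gamma>"
    and nonneg: "\<forall>t. 0 \<le> t \<and> ereal t < \<gamma> \<longrightarrow> 0 \<le> \<psi> t"
    and nonzero: "\<exists>t. 0 \<le> t \<and> ereal t < \<gamma> \<and> \<psi> t \<noteq> 0"
    and mono: "mono_on {t. 0 \<le> t \<and> ereal t < \<gamma>} \<psi>"
    and concave: "concave_on {t. 0 \<le> t \<and> ereal t < \<gamma>} \<psi>"
    and zero: "\<psi> 0 = 0"
begin

abbreviation Dom :: "real set" where
  "Dom \<equiv> {t. 0 \<le> t \<and> ereal t < \<gamma>}"

lemma Dom_downward: "t \<in> Dom \<Longrightarrow> 0 \<le> s \<Longrightarrow> s \<le> t \<Longrightarrow> s \<in> Dom"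
  by (auto intro: le_less_trans[of "ereal s" "ereal t"])

lemma ivl_downward: "t \<in> ivl \<gamma> \<Longrightarrow> 0 < s \<Longrightarrow> s \<le> t \<Longrightarrow> s \<in> ivl \<gamma>"
  by (auto simp: ivl_def intro: le_less_trans[of "ereal s" "ereal t"])

lemma Ioo_subset_ivl: "b \<in> ivl \<gamma> \<Longrightarrow> {0<..<b} \<subseteq> ivl \<gamma>"
  using ivl_downward by auto

lemma ex_in_ivl: "\<exists>b. b \<in> ivl \<gamma>"
proof (cases \<gamma>)
  case (real r)
  then have "r / 2 \<in> ivl \<gamma>"
    using gamma_pos by (simp add: ivl_def)
  then show ?thesis ..
next
  case PInf
  then show ?thesis
    by (intro exI[of _ 1]) (simp add: ivl_def)
next
  case MInf
  then show ?thesis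
    using gamma_pos by simp
qed

lemma psi_mono: "s \<in> Dom \<Longrightarrow> t \<in> Dom \<Longrightarrow> s \<le> t \<Longrightarrow> \<psi> s \<le> \<psi> t"
  using mono by (auto simp: mono_on_def)

lemma psi_nonneg: "t \<in> Dom \<Longrightarrow> 0 \<le> \<psi> t"
  using nonneg by auto

lemma psi_scale_ge:
  assumes "t \<in> Dom" "0 \<le> \<theta>" "\<theta> \<le> 1"
  shows "\<theta> * \<psi> t \<le> \<psi> (\<theta> * t)"
proof -
  have "0 \<in> Dom"
    using gamma_pos by (simp add: zero_ereal_def)
  from concave_onD[OF concave assms(2,3) this assms(1)] show ?thesis
    using zero by simp
qed

lemma psi_ratio_ge:
  assumes "t \<in> Dom" "0 < s" "s \<le> t"
  shows "s / t * \<psi> t \<le> \<psi> s"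
  using psi_scale_ge[OF assms(1), of "s / t"] assms by (simp add: field_simps)

lemma psi_pos:
  assumes "t \<in> ivl \<gamma>"
  shows "0 < \<psi> t"
proof -
  obtain t0 where t0: "t0 \<in> Dom" "\<psi> t0 \<noteq> 0"
    using nonzero by auto
  have p0: "0 < \<psi> t0"
    using t0 psi_nonneg by force
  have "0 < t0"
    using t0 zero by (cases "t0 = 0") auto
  have t: "t \<in> Dom" "0 < t"
    using assms by (auto simp: ivl_def)
  show ?thesis
  proof (cases "t0 \<le> t")
    case True
    then show ?thesis
      using psi_mono[OF t0(1) t(1)] p0 by simp
  next
    case False
    then have "t / t0 * \<psi> t0 \<le> \<psi> t"
      using psi_ratio_ge[OF t0(1) t(2)] by simp
    moreover have "0 < t / t0 * \<psi> t0"
      using t \<open>0 < t0\<close> p0 by simp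
    ultimately show ?thesis
      by simp
  qed
qed

lemma psi_div_antimono:
  assumes "t \<in> Dom" "0 < s" "s \<le> t"
  shows "\<psi> t / t \<le> \<psi> s / s"
  using psi_ratio_ge[OF assms] assms by (simp add: field_simps)

text \<open>Concavity on the three points \<open>t < 2t \<le> Kt\<close>.\<close>

lemma psi_dilate_le:
  assumes t: "0 < t" and K: "2 \<le> K" and Kt: "K * t \<in> Dom"
  shows "\<psi> (K * t) \<le> \<psi> t + (K - 1) * (\<psi> (2 * t) - \<psi> t)"
proof (cases "K = 2")
  case True
  then show ?thesis by simp
next
  case False
  then have K2: "2 < K"
    using K by simp
  define \<theta> where "\<theta> = 1 / (K - 1)"
  have \<theta>: "0 \<le> \<theta>" "\<theta> \<le> 1"
    using K2 by (auto simp: \<theta>_def)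
  have tD: "t \<in> Dom"
    using Dom_downward[OF Kt] t K by auto
  have "(1 - \<theta>) * t + \<theta> * (K * t) = 2 * t"
  proof -
    have "(1 - \<theta>) * t + \<theta> * (K * t) = t + (\<theta> * (K - 1)) * t"
      by (simp add: algebra_simps)
    also have "\<theta> * (K - 1) = 1"
      using K2 by (simp add: \<theta>_def)
    finally show ?thesis
      by simp
  qed
  then have "(1 - \<theta>) * \<psi> t + \<theta> * \<psi> (K * t) \<le> \<psi> (2 * t)"
    using concave_onD[OF concave \<theta> tD Kt] by simp
  then have "(K - 1) * (\<theta> * \<psi> (K * t)) \<le> (K - 1) * (\<psi> (2 * t) - (1 - \<theta>) * \<psi> t)"
    using K2 by (intro mult_left_mono) auto
  moreover have "(K - 1) * (\<theta> * \<psi> (K * t)) = \<psi> (K * t)"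
    using K2 by (simp add: \<theta>_def)
  moreover have "(K - 1) * (\<psi> (2 * t) - (1 - \<theta>) * \<psi> t) = \<psi> t + (K - 1) * (\<psi> (2 * t) - \<psi> t)"
    using K2 by (simp add: \<theta>_def field_simps)
  ultimately show ?thesis
    by simp
qed

lemma psi_chord_le:
  assumes e: "e \<in> ivl \<gamma>" and \<tau>: "\<tau> \<in> ivl \<gamma>"
  shows "\<psi> e / e * min \<tau> e \<le> \<psi> \<tau>"
proof (cases "\<tau> \<le> e")
  case True
  then have "\<psi> e / e * min \<tau> e = \<tau> / e * \<psi> e"
    by (simp add: min_def)
  also have "\<dots> \<le> \<psi> \<tau>"
    using psi_ratio_ge e \<tau> True by (simp add: ivl_def)
  finally show ?thesis .
next
  case False
  then have "\<psi> e / e * min \<tau> e = \<psi> e"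
    using e by (simp add: min_def ivl_def)
  also have "\<dots> \<le> \<psi> \<tau>"
    using psi_mono e \<tau> False by (simp add: ivl_def)
  finally show ?thesis .
qed

lemma nn_integral_rearr_le_M_norm:
  assumes f: "f \<in> M_space \<gamma> \<psi>" and b: "b \<in> ivl \<gamma>"
  shows "(\<integral>\<^sup>+ u\<in>{0<..<b}. rearr \<gamma> f u \<partial>lborel) \<le> ennreal (M_rnorm \<gamma> \<psi> f * \<psi> b)"
proof -
  let ?I = "\<integral>\<^sup>+ u\<in>{0<..<b}. rearr \<gamma> f u \<partial>lborel"
  have p: "0 < \<psi> b"
    by (rule psi_pos[OF b])
  have "?I / ennreal (\<psi> b) \<le> M_norm \<gamma> \<psi> f"
    unfolding M_norm_def by (rule SUP_upper[OF b])
  then have "?I / ennreal (\<psi> b) * ennreal (\<psi> b) \<le> M_norm \<gamma> \<psi> f * ennreal (\<psi> b)"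
    by (rule mult_right_mono) simp
  moreover have "?I / ennreal (\<psi> b) * ennreal (\<psi> b) = ?I"
    using p by (simp add: ennreal_divide_times ennreal_times_divide divide_ennreal[symmetric]
        mult_divide_eq_ennreal)
  moreover have "M_norm \<gamma> \<psi> f * ennreal (\<psi> b) = ennreal (M_rnorm \<gamma> \<psi> f * \<psi> b)"
    using f p by (simp add: M_space_def M_rnorm_def ennreal_mult)
  ultimately show ?thesis
    by simp
qed

lemma M_rnorm_le_1I:
  assumes meas: "set_borel_measurable lebesgue (ivl \<gamma>) h"
    and le: "\<And>t. t \<in> ivl \<gamma> \<Longrightarrow> (\<integral>\<^sup>+ u\<in>{0<..<t}. rearr \<gamma> h u \<partial>lborel) \<le> ennreal (\<psi> t)"
  shows "h \<in> M_space \<gamma> \<psi>" "M_rnorm \<gamma> \<psi> h \<le> 1"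
proof -
  have "M_norm \<gamma> \<psi> h \<le> 1"
    unfolding M_norm_def
    using le psi_pos by (intro SUP_least) (simp add: divide_le_posI_ennreal)
  then show "h \<in> M_space \<gamma> \<psi>" "M_rnorm \<gamma> \<psi> h \<le> 1"
    using meas by (auto simp: M_space_def M_rnorm_def enn2real_leI le_less_trans)
qed

lemma nn_integral_abs_le_M_rnorm:
  assumes f: "f \<in> M_space \<gamma> \<psi>" and b: "b \<in> ivl \<gamma>"
  shows "(\<integral>\<^sup>+ x\<in>{0<..<b}. ennreal \<bar>f x\<bar> \<partial>lebesgue) \<le> ennreal (M_rnorm \<gamma> \<psi> f * \<psi> b)"
proof -
  have "(\<integral>\<^sup>+ x\<in>{0<..<b}. ennreal \<bar>f x\<bar> \<partial>lebesgue) \<le> (\<integral>\<^sup>+ u\<in>{0<..<b}. rearr \<gamma> f u \<partial>lborel)"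
    using f Ioo_subset_ivl[OF b] b by (intro nn_integral_le_rearr) (auto simp: M_space_def ivl_def)
  also have "\<dots> \<le> ennreal (M_rnorm \<gamma> \<psi> f * \<psi> b)"
    by (rule nn_integral_rearr_le_M_norm[OF f b])
  finally show ?thesis .
qed

lemma set_integrable_M_space:
  assumes f: "f \<in> M_space \<gamma> \<psi>" and E: "E \<in> sets lebesgue" "E \<subseteq> {0<..<b}" and b: "b \<in> ivl \<gamma>"
  shows "set_integrable lebesgue E f"
  unfolding set_integrable_def
proof (rule integrableI_bounded)
  have "(\<lambda>x. indicator E x * (indicator (ivl \<gamma>) x * f x)) \<in> borel_measurable lebesgue"
    using set_borel_measurable_ivlD f E by (auto simp: M_space_def)
  moreover have "(\<lambda>x. indicator E x * (indicator (ivl \<gamma>) x * f x)) = (\<lambda>x. indicator E x *\<^sub>R f x)"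
    using E Ioo_subset_ivl[OF b] by (auto simp: fun_eq_iff indicator_def)
  ultimately show "(\<lambda>x. indicator E x *\<^sub>R f x) \<in> borel_measurable lebesgue"
    by simp
  have "(\<integral>\<^sup>+ x. ennreal (norm (indicator E x *\<^sub>R f x)) \<partial>lebesgue)
      \<le> (\<integral>\<^sup>+ x\<in>{0<..<b}. ennreal \<bar>f x\<bar> \<partial>lebesgue)"
    using E by (intro nn_integral_mono) (auto simp: indicator_def)
  also have "\<dots> < \<infinity>"
    using nn_integral_abs_le_M_rnorm[OF f b] by (simp add: le_less_trans)
  finally show "(\<integral>\<^sup>+ x. ennreal (norm (indicator E x *\<^sub>R f x)) \<partial>lebesgue) < \<infinity>" .
qed

lemma sum_set_integral_abs_le:
  assumes f: "f \<in> M_space \<gamma> \<psi>" and J: "finite J" and disj: "disjoint_family_on E J"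
    and E: "\<And>j. j \<in> J \<Longrightarrow> E j \<in> sets lebesgue" "\<And>j. j \<in> J \<Longrightarrow> E j \<subseteq> {0<..<b}"
    and b: "b \<in> ivl \<gamma>"
  shows "(\<Sum>j\<in>J. LINT x:E j|lebesgue. \<bar>f x\<bar>) \<le> M_rnorm \<gamma> \<psi> f * \<psi> b"
proof -
  let ?U = "\<Union>j\<in>J. E j"
  have U: "?U \<in> sets lebesgue" "?U \<subseteq> {0<..<b}"
    using J E by auto
  have int: "set_integrable lebesgue A (\<lambda>x. \<bar>f x\<bar>)"
    if "A \<in> sets lebesgue" "A \<subseteq> {0<..<b}" for A
    using set_integrable_M_space[OF M_space_abs[OF f] that b] .
  have "(\<Sum>j\<in>J. LINT x:E j|lebesgue. \<bar>f x\<bar>) = (LINT x:?U|lebesgue. \<bar>f x\<bar>)"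
    using J disj E int by (intro set_integral_finite_Union[symmetric]) auto
  also have "ennreal \<dots> = (\<integral>\<^sup>+ x. ennreal (indicator ?U x *\<^sub>R \<bar>f x\<bar>) \<partial>lebesgue)"
    using int[OF U] unfolding set_lebesgue_integral_def set_integrable_def
    by (intro nn_integral_eq_integral[symmetric]) auto
  also have "\<dots> \<le> (\<integral>\<^sup>+ x\<in>{0<..<b}. ennreal \<bar>f x\<bar> \<partial>lebesgue)"
    using U by (intro nn_integral_mono) (auto simp: indicator_def)
  also have "\<dots> \<le> ennreal (M_rnorm \<gamma> \<psi> f * \<psi> b)"
    by (rule nn_integral_abs_le_M_rnorm[OF f b])
  finally show ?thesis
    using psi_pos[OF b] M_rnorm_nonneg[of \<gamma> \<psi> f] by (simp add: ennreal_le_iff)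
qed

lemma set_integral_nonneg_ivl:
  fixes f :: "real \<Rightarrow> real"
  assumes "E \<subseteq> ivl \<gamma>" "AE x in lebesgue. x \<in> ivl \<gamma> \<longrightarrow> 0 \<le> f x"
  shows "0 \<le> (LINT x:E|lebesgue. f x)"
  unfolding set_lebesgue_integral_def
  by (rule integral_nonneg_AE) (use assms in \<open>auto simp: indicator_def elim: AE_mp\<close>)

lemma step_fn_in_unit_ball:
  assumes E: "\<And>k. E k \<in> sets borel" "disjoint_family E"
    and e: "\<And>k. emeasure lebesgue (E k) \<le> ennreal (e k)"
    and v: "\<And>k. 0 \<le> v k"
    and le: "\<And>\<tau>. \<tau> \<in> ivl \<gamma> \<Longrightarrow> (\<Sum>k. ennreal (v k) * min (ennreal \<tau>) (ennreal (e k))) \<le> ennreal (\<psi> \<tau>)"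
  shows "step_fn E v \<in> M_space \<gamma> \<psi>" "M_rnorm \<gamma> \<psi> (step_fn E v) \<le> 1"
proof -
  have "(\<integral>\<^sup>+ u\<in>{0<..<\<tau>}. rearr \<gamma> (step_fn E v) u \<partial>lborel) \<le> ennreal (\<psi> \<tau>)"
    if "\<tau> \<in> ivl \<gamma>" for \<tau>
    using nn_integral_rearr_step_fn_le[where v=v and t=\<tau> and \<gamma>=\<gamma>, OF E e v] le[OF that] that
    by (auto simp: ivl_def)
  then show "step_fn E v \<in> M_space \<gamma> \<psi>" "M_rnorm \<gamma> \<psi> (step_fn E v) \<le> 1"
    using M_rnorm_le_1I[OF set_borel_measurable_step_fn[OF E(1)]] by auto
qed

lemma positive_functional_series_set_integral:
  assumes E: "\<And>j. E j \<in> sets lebesgue" "\<And>j. \<exists>b\<in>ivl \<gamma>. E j \<subseteq> {0<..<b}"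
    and w: "\<And>j. 0 \<le> w j"
    and sums: "\<And>N f. f \<in> M_space \<gamma> \<psi>
      \<Longrightarrow> (\<Sum>j<N. w j * (LINT x:E j|lebesgue. \<bar>f x\<bar>)) \<le> C * M_rnorm \<gamma> \<psi> f"
  shows "positive_functional_series \<gamma> \<psi> C (\<lambda>j f. w j * (LINT x:E j|lebesgue. f x))"
proof
  have int: "set_integrable lebesgue (E j) f" if "f \<in> M_space \<gamma> \<psi>" for j f
    using E(2)[of j] set_integrable_M_space[OF that E(1)] by blast
  fix j
  show "w j * (LINT x:E j|lebesgue. f x + g x)
      = w j * (LINT x:E j|lebesgue. f x) + w j * (LINT x:E j|lebesgue. g x)"
    if "f \<in> M_space \<gamma> \<psi>" "g \<in> M_space \<gamma> \<psi>" for f g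
    using int[OF that(1)] int[OF that(2)] by (simp add: distrib_left)
  show "w j * (LINT x:E j|lebesgue. c * f x) = c * (w j * (LINT x:E j|lebesgue. f x))" for f c
    by simp
  show "0 \<le> w j * (LINT x:E j|lebesgue. f x)"
    if "AE x in lebesgue. x \<in> ivl \<gamma> \<longrightarrow> 0 \<le> f x" for f
    using E(2)[of j] Ioo_subset_ivl w[of j]
    by (intro mult_nonneg_nonneg set_integral_nonneg_ivl[OF _ that]) blast+
  show "\<bar>w j * (LINT x:E j|lebesgue. f x)\<bar> \<le> w j * (LINT x:E j|lebesgue. \<bar>f x\<bar>)"
    if "f \<in> M_space \<gamma> \<psi>" for f
    using set_integral_norm_bound[OF int[OF that]] w[of j] by (simp add: abs_mult mult_left_mono)
qed (rule sums)

subsection \<open>Functionals on disjoint intervals\<close>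

lemma block_in_unit_ball:
  assumes A: "A \<in> sets borel" "emeasure lebesgue A \<le> ennreal e" and e: "e \<in> ivl \<gamma>"
  shows "(\<lambda>x. \<psi> e / e * indicator A x) \<in> M_space \<gamma> \<psi>"
    and "M_rnorm \<gamma> \<psi> (\<lambda>x. \<psi> e / e * indicator A x) \<le> 1"
proof -
  define E where "E k = (if k = 0 then A else {})" for k :: nat
  define v where "v k = (if k = 0 then \<psi> e / e else 0)" for k :: nat
  have v: "0 \<le> v k" for k
    using psi_pos[OF e] e by (simp add: v_def ivl_def)
  have "step_fn E v = (\<lambda>x. \<psi> e / e * indicator A x)"
    unfolding step_fn_def fun_eq_iff by (subst suminf_finite[of "{0}"]) (auto simp: E_def v_def)
  moreover have "(\<Sum>k. ennreal (v k) * min (ennreal \<tau>) (ennreal e)) \<le> ennreal (\<psi> \<tau>)"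
    if \<tau>: "\<tau> \<in> ivl \<gamma>" for \<tau>
  proof -
    have "(\<Sum>k. ennreal (v k) * min (ennreal \<tau>) (ennreal e)) = ennreal (\<psi> e / e * min \<tau> e)"
      using \<tau> e v[of 0] by (subst suminf_finite[of "{0}"])
        (auto simp: v_def ivl_def min_ennreal ennreal_mult[symmetric])
    also have "\<dots> \<le> ennreal (\<psi> \<tau>)"
      using psi_chord_le[OF e \<tau>] by (rule ennreal_leI)
    finally show ?thesis .
  qed
  then have "step_fn E v \<in> M_space \<gamma> \<psi>" "M_rnorm \<gamma> \<psi> (step_fn E v) \<le> 1"
    using A v by (auto intro!: step_fn_in_unit_ball[where e="\<lambda>_. e"]
        simp: E_def disjoint_family_on_def)
  ultimately show "(\<lambda>x. \<psi> e / e * indicator A x) \<in> M_space \<gamma> \<psi>"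
    and "M_rnorm \<gamma> \<psi> (\<lambda>x. \<psi> e / e * indicator A x) \<le> 1"
    by simp_all
qed

lemma not_dual_order_continuous_disjoint_blocks:
  fixes a e :: "nat \<Rightarrow> real"
  assumes a: "\<And>j. 0 \<le> a j" and e: "\<And>j. e j \<in> ivl \<gamma>"
    and disj: "disjoint_family (\<lambda>j. {a j<..<a j + e j})"
    and cover: "\<And>N. \<exists>b\<in>ivl \<gamma>. \<psi> b \<le> C \<and> (\<forall>j<N. a j + e j \<le> b)"
    and c: "0 < c" "\<And>j. c \<le> \<psi> (e j)"
  shows "\<not> dual_order_continuous \<gamma> \<psi>"
proof -
  define E where "E j = {a j<..<a j + e j}" for j
  have e0: "0 < e j" for j
    using e[of j] by (simp add: ivl_def)
  have "positive_functional_series \<gamma> \<psi> C (\<lambda>j f. LINT x:E j|lebesgue. f x)"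
  proof (rule positive_functional_series_set_integral[where w="\<lambda>_. 1", simplified])
    fix j
    show "E j \<in> sets lebesgue"
      by (simp add: E_def)
    obtain b where "b \<in> ivl \<gamma>" "\<forall>i<Suc j. a i + e i \<le> b"
      using cover by blast
    then have "E j \<subseteq> {0<..<b}"
      using a[of j] by (auto simp: E_def)
    with \<open>b \<in> ivl \<gamma>\<close> show "\<exists>b\<in>ivl \<gamma>. E j \<subseteq> {0<..<b}" ..
  next
    fix N f
    assume f: "f \<in> M_space \<gamma> \<psi>"
    obtain b where b: "b \<in> ivl \<gamma>" "\<psi> b \<le> C" "\<forall>j<N. a j + e j \<le> b"
      using cover by blast
    have "E j \<subseteq> {0<..<b}" if "j < N" for j
      using a[of j] b(3) that by (fastforce simp: E_def)
    then have "(\<Sum>j<N. LINT x:E j|lebesgue. \<bar>f x\<bar>) \<le> M_rnorm \<gamma> \<psi> f * \<psi> b"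
      using disj by (intro sum_set_integral_abs_le[OF f _ _ _ _ b(1)])
        (auto simp: E_def disjoint_family_on_def)
    also have "\<dots> \<le> C * M_rnorm \<gamma> \<psi> f"
      using b(2) M_rnorm_nonneg[of \<gamma> \<psi> f] by (simp add: mult.commute mult_right_mono)
    finally show "(\<Sum>j<N. LINT x:E j|lebesgue. \<bar>f x\<bar>) \<le> C * M_rnorm \<gamma> \<psi> f" .
  qed
  moreover have "c \<le> (LINT x:E j|lebesgue. \<psi> (e j) / e j * indicator (E j) x)" for j
  proof -
    have "(LINT x:E j|lebesgue. \<psi> (e j) / e j * indicator (E j) x)
        = (LINT x:E j|lebesgue. \<psi> (e j) / e j)"
      by (rule set_lebesgue_integral_cong) (auto simp: E_def)
    also have "\<dots> = measure lebesgue (E j) *\<^sub>R (\<psi> (e j) / e j)"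
      using e0[of j] by (intro set_integral_const) (simp_all add: E_def)
    also have "\<dots> = \<psi> (e j)"
      using e0[of j] by (simp add: E_def)
    finally have "(LINT x:E j|lebesgue. \<psi> (e j) / e j * indicator (E j) x) = \<psi> (e j)" .
    then show ?thesis
      using c(2)[of j] e0[of j] by simp
  qed
  ultimately show ?thesis
    using block_in_unit_ball[of "E j" "e j" for j] e e0 c(1) psi_pos[OF e]
    by (intro positive_functional_series.not_dual_order_continuous[where c=c])
      (auto simp: E_def less_imp_le)
qed

lemma not_dual_order_continuous_if_psi_bounded_below:
  assumes c: "0 < c" "\<And>s. s \<in> ivl \<gamma> \<Longrightarrow> c \<le> \<psi> s"
  shows "\<not> dual_order_continuous \<gamma> \<psi>"
proof -
  obtain b where b: "b \<in> ivl \<gamma>"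
    using ex_in_ivl by blast
  then have "0 < b"
    by (simp add: ivl_def)
  define a where "a j = b / 2 ^ Suc j" for j :: nat
  have a: "0 < a j" "a j + a j = b / 2 ^ j" "a j \<in> ivl \<gamma>" for j
  proof -
    show "0 < a j" "a j + a j = b / 2 ^ j"
      using \<open>0 < b\<close> by (simp_all add: a_def)
    have "a j \<le> b"
      using \<open>0 < b\<close> one_le_power[of "2::real" "Suc j"] by (simp add: a_def divide_le_eq)
    then show "a j \<in> ivl \<gamma>"
      using ivl_downward[OF b \<open>0 < a j\<close>] by simp
  qed
  have "disjoint_family (\<lambda>j. {a j<..<a j + a j})"
  proof (rule disjoint_family_Ioo_descending)
    show "a j \<le> a j + a j" for j
      using a(1)[of j] by simp
    show "a (Suc j) + a (Suc j) \<le> a j" for j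
      by (simp only: a(2)) (simp add: a_def)
  qed
  moreover have "\<forall>j<N. a j + a j \<le> b" for N
    using \<open>0 < b\<close> one_le_power[of "2::real"] by (simp add: a(2) divide_le_eq)
  ultimately show ?thesis
    using a(1,3) b c
    by (intro not_dual_order_continuous_disjoint_blocks[where a=a and e=a and C="\<psi> b"])
      (auto intro: less_imp_le)
qed

lemma not_dual_order_continuous_if_psi_bounded:
  assumes \<gamma>: "\<gamma> = \<infinity>" and C: "\<And>s. 0 \<le> s \<Longrightarrow> \<psi> s \<le> C"
  shows "\<not> dual_order_continuous \<gamma> \<psi>"
proof -
  have ivl: "s \<in> ivl \<gamma> \<longleftrightarrow> 0 < s" for s
    by (simp add: ivl_def \<gamma>)
  have "disjoint_family (\<lambda>j. {2 ^ j<..<(2::real) ^ j + 2 ^ j})"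
    by (rule disjoint_family_Ioo_ascending) simp_all
  moreover have "\<exists>b\<in>ivl \<gamma>. \<psi> b \<le> C \<and> (\<forall>j<N. (2::real) ^ j + 2 ^ j \<le> b)" for N
    using C[of "2 ^ N"] ivl
    by (intro bexI[of _ "2 ^ N"]) (auto simp flip: power_Suc intro: power_increasing)
  moreover have "\<psi> 1 \<le> \<psi> (2 ^ j)" for j
    using \<gamma> by (intro psi_mono) auto
  ultimately show ?thesis
    using psi_pos[of 1] ivl
    by (intro not_dual_order_continuous_disjoint_blocks[where a="\<lambda>j. 2 ^ j" and e="\<lambda>j. 2 ^ j"
          and C=C and c="\<psi> 1"]) auto
qed

subsection \<open>Functionals on dilated intervals\<close>

lemma positive_functional_series_cell_averages:
  assumes s: "0 < s" and m: "real m * s \<in> ivl \<gamma>"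
  shows "positive_functional_series \<gamma> \<psi> 1 (\<lambda>j f. 1 / \<psi> (m * s) * (LINT x:cell s m j|lebesgue. f x))"
proof (rule positive_functional_series_set_integral)
  have sub: "cell s m j \<subseteq> {0<..<m * s}" for j
    using cell_subset[OF s] s by fastforce
  then show "\<exists>b\<in>ivl \<gamma>. cell s m j \<subseteq> {0<..<b}" for j
    using m by blast
  show "0 \<le> 1 / \<psi> (m * s)"
    using psi_pos[OF m] by simp
  fix N f
  assume f: "f \<in> M_space \<gamma> \<psi>"
  have "(\<Sum>j<N. LINT x:cell s m j|lebesgue. \<bar>f x\<bar>) \<le> M_rnorm \<gamma> \<psi> f * \<psi> (m * s)"
    using disjoint_family_cell[OF s] sub
    by (intro sum_set_integral_abs_le[OF f _ _ _ _ m]) (auto simp: disjoint_family_on_def)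
  then show "(\<Sum>j<N. 1 / \<psi> (m * s) * (LINT x:cell s m j|lebesgue. \<bar>f x\<bar>)) \<le> 1 * M_rnorm \<gamma> \<psi> f"
    using psi_pos[OF m] by (simp add: sum_divide_distrib[symmetric] divide_le_eq mult.commute)
qed simp

lemma cells_step_fn_in_unit_ball:
  fixes t :: "nat \<Rightarrow> real" and n :: nat
  assumes t: "\<And>k. 0 < t k" and u: "\<And>k. real (k + 8) * t k \<in> ivl \<gamma>"
    and disj: "disjoint_family (\<lambda>k. {t k<..<real (k + 8) * t k})"
    and sum_le: "\<And>\<tau>. \<tau> \<in> ivl \<gamma>
      \<Longrightarrow> (\<Sum>k. ennreal (\<psi> (real (k + 8) * t k) * min 1 (\<tau> / t k))) \<le> ennreal (8 * \<psi> \<tau>)"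
  defines "h \<equiv> step_fn (\<lambda>k. cell (t k) (k + 8) n) (\<lambda>k. \<psi> (real (k + 8) * t k) / (8 * t k))"
  shows "h \<in> M_space \<gamma> \<psi>" and "M_rnorm \<gamma> \<psi> h \<le> 1"
proof -
  define u where "u k = real (k + 8) * t k" for k
  have psi_u: "0 < \<psi> (u k)" for k
    using psi_pos[OF u] by (simp add: u_def)
  have "(\<Sum>k. ennreal (\<psi> (u k) / (8 * t k)) * min (ennreal \<tau>) (ennreal (t k))) \<le> ennreal (\<psi> \<tau>)"
    if \<tau>: "\<tau> \<in> ivl \<gamma>" for \<tau>
  proof -
    have "ennreal (\<psi> (u k) / (8 * t k)) * min (ennreal \<tau>) (ennreal (t k))
        = ennreal (1 / 8) * ennreal (\<psi> (u k) * min 1 (\<tau> / t k))" for k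
    proof -
      have nonneg: "0 \<le> \<psi> (u k) / (8 * t k)" "0 \<le> \<psi> (u k) * min 1 (\<tau> / t k)" "0 \<le> \<tau>"
        using t[of k] psi_u[of k] \<tau> by (simp_all add: ivl_def)
      have "ennreal (\<psi> (u k) / (8 * t k)) * min (ennreal \<tau>) (ennreal (t k))
          = ennreal (\<psi> (u k) / (8 * t k) * min \<tau> (t k))"
        using nonneg t[of k] by (simp add: min_ennreal ennreal_mult[symmetric] less_imp_le)
      also have "\<psi> (u k) / (8 * t k) * min \<tau> (t k) = 1 / 8 * (\<psi> (u k) * min 1 (\<tau> / t k))"
        using t[of k] by (cases "\<tau> \<le> t k") (simp_all add: min_def)
      also have "ennreal \<dots> = ennreal (1 / 8) * ennreal (\<psi> (u k) * min 1 (\<tau> / t k))"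
        using nonneg by (intro ennreal_mult) simp_all
      finally show ?thesis .
    qed
    then have "(\<Sum>k. ennreal (\<psi> (u k) / (8 * t k)) * min (ennreal \<tau>) (ennreal (t k)))
        = ennreal (1 / 8) * (\<Sum>k. ennreal (\<psi> (u k) * min 1 (\<tau> / t k)))"
      by (simp add: ennreal_suminf_cmult)
    also have "\<dots> \<le> ennreal (1 / 8) * ennreal (8 * \<psi> \<tau>)"
      using sum_le[OF \<tau>] by (intro mult_left_mono) (simp_all add: u_def)
    also have "\<dots> = ennreal (\<psi> \<tau>)"
      using psi_pos[OF \<tau>] by (simp add: ennreal_mult[symmetric])
    finally show ?thesis .
  qed
  moreover have "0 \<le> \<psi> (u k) / (8 * t k)" for k
    using psi_u[of k] t[of k] by simp
  ultimately show "h \<in> M_space \<gamma> \<psi>" "M_rnorm \<gamma> \<psi> h \<le> 1"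
    unfolding h_def u_def using disjoint_family_cells[OF t disj] emeasure_cell_le t
    by (auto intro!: step_fn_in_unit_ball[where e=t])
qed

text \<open>The \<open>j\<close>-th functional is a Banach limit in \<open>k\<close> of the averages over the \<open>j\<close>-th cells of
  \<open>(t\<^sub>k, (k + 8)t\<^sub>k)\<close>, weighted by \<open>1/\<psi>((k + 8)t\<^sub>k)\<close>; the test vector \<open>h\<^sub>n\<close> has height
  \<open>\<psi>((k + 8)t\<^sub>k)/(8t\<^sub>k)\<close> on the \<open>n\<close>-th cell of every interval.\<close>

lemma not_dual_order_continuous_dilated_blocks:
  fixes t :: "nat \<Rightarrow> real"
  assumes t: "\<And>k. 0 < t k" and u: "\<And>k. real (k + 8) * t k \<in> ivl \<gamma>"
    and disj: "disjoint_family (\<lambda>k. {t k<..<real (k + 8) * t k})"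
    and sum_le: "\<And>\<tau>. \<tau> \<in> ivl \<gamma>
      \<Longrightarrow> (\<Sum>k. ennreal (\<psi> (real (k + 8) * t k) * min 1 (\<tau> / t k))) \<le> ennreal (8 * \<psi> \<tau>)"
  shows "\<not> dual_order_continuous \<gamma> \<psi>"
proof -
  define u where "u k = real (k + 8) * t k" for k
  define \<phi> where "\<phi> k j f = 1 / \<psi> (u k) * (LINT x:cell (t k) (k + 8) j|lebesgue. f x)" for k j f
  obtain U :: "nat filter" where U: "U \<le> sequentially" "ultrafilter U"
    using ex_ultrafilter_le[of sequentially] by auto
  define \<Psi> where "\<Psi> j f = Lim U (\<lambda>k. \<phi> k j f)" for j f
  define h where "h n = step_fn (\<lambda>k. cell (t k) (k + 8) n) (\<lambda>k. \<psi> (u k) / (8 * t k))" for n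
  have "positive_functional_series \<gamma> \<psi> 1 \<Psi>"
    unfolding \<Psi>_def \<phi>_def u_def
    using positive_functional_series_cell_averages[OF t u]
    by (intro positive_functional_series_Lim[OF U(2)]) simp
  moreover have "h n \<in> M_space \<gamma> \<psi>" "M_rnorm \<gamma> \<psi> (h n) \<le> 1" for n
    unfolding h_def u_def using cells_step_fn_in_unit_ball[OF t u disj sum_le] by simp_all
  moreover have "0 \<le> h n x" for n x
    unfolding h_def using psi_pos[OF u] t
    by (intro step_fn_nonneg disjoint_family_cells[OF t disj]) (simp add: u_def less_imp_le)
  moreover have "\<Psi> n (h n) = 1 / 8" for n
  proof -
    have "\<phi> k n (h n) = 1 / 8" if "n \<le> k" for k
    proof -
      have "(LINT x:cell (t k) (k + 8) n|lebesgue. h n x)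
          = (LINT x:cell (t k) (k + 8) n|lebesgue. \<psi> (u k) / (8 * t k))"
        unfolding h_def
        by (rule set_lebesgue_integral_cong)
          (auto intro: step_fn_eq[OF disjoint_family_cells[OF t disj]])
      also have "\<dots> = t k * (\<psi> (u k) / (8 * t k))"
        using that t[of k] by (subst set_integral_const) (simp_all add: cell_def algebra_simps)
      finally show ?thesis
        using t[of k] psi_pos[OF u[of k]] by (simp add: \<phi>_def u_def)
    qed
    then have "((\<lambda>k. \<phi> k n (h n)) \<longlongrightarrow> 1 / 8) U"
      by (intro tendsto_eventually filter_leD[OF U(1)] eventually_sequentiallyI)
    then show ?thesis
      unfolding \<Psi>_def by (rule tendsto_Lim[OF ultrafilter_not_bot[OF U(2)]])
  qed
  ultimately show ?thesis
    by (intro positive_functional_series.not_dual_order_continuous[where c="1 / 8" and h=h]) auto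
qed

lemma dilation_le_double:
  assumes t: "t \<in> ivl \<gamma>" and K: "2 \<le> K" and Kt: "real K * t \<in> ivl \<gamma>"
    and ratio: "\<psi> (2 * t) / \<psi> t < 1 + 1 / real K"
  shows "\<psi> (real K * t) \<le> 2 * \<psi> t"
proof -
  have p: "0 < \<psi> t"
    by (rule psi_pos[OF t])
  have K': "2 \<le> real K"
    using K by simp
  have "\<psi> (2 * t) - \<psi> t \<le> \<psi> t / real K"
    using ratio p by (simp add: divide_less_eq field_simps)
  then have "(real K - 1) * (\<psi> (2 * t) - \<psi> t) \<le> (real K - 1) * (\<psi> t / real K)"
    using K' by (intro mult_left_mono) auto
  moreover have "\<psi> (real K * t) \<le> \<psi> t + (real K - 1) * (\<psi> (2 * t) - \<psi> t)"
    using psi_dilate_le[of t "real K"] t Kt K' by (simp add: ivl_def)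
  ultimately have "\<psi> (real K * t) \<le> \<psi> t + (real K - 1) * (\<psi> t / real K)"
    by linarith
  also have "\<dots> \<le> \<psi> t + real K * (\<psi> t / real K)"
    using p K' by (intro add_left_mono mult_right_mono) auto
  finally show ?thesis
    using K' by simp
qed

lemma ex_dilation_le_double_near_zero:
  assumes L: "\<not> 1 < Liminf (at_right 0) (\<lambda>t. ereal (\<psi> (2 * t) / \<psi> t))"
    and K: "2 \<le> K" and p: "p \<in> ivl \<gamma>"
  shows "\<exists>t>0. real K * t \<le> p \<and> \<psi> (real K * t) \<le> 2 * \<psi> t"
proof -
  have p0: "0 < p" and K': "2 \<le> real K"
    using p K by (simp_all add: ivl_def)
  have "\<exists>\<^sub>F t in at_right 0. \<psi> (2 * t) / \<psi> t < 1 + 1 / real K"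
    using L K' by (intro frequently_less_if_not_Liminf_greater) (simp_all add: one_ereal_def)
  moreover have "eventually (\<lambda>t. 0 < t \<and> t < p / real K) (at_right (0::real))"
    using p0 K' by (auto simp: eventually_at_right_field intro!: exI[of _ "p / real K"])
  ultimately obtain t where t: "0 < t" "t < p / real K" "\<psi> (2 * t) / \<psi> t < 1 + 1 / real K"
    by (metis (mono_tags, lifting) frequently_eventually_conj frequently_ex)
  then have Kt: "real K * t < p"
    using K' by (simp add: field_simps)
  moreover have "t \<le> real K * t"
    using t(1) K' by simp
  ultimately have "t \<le> p"
    by linarith
  then have "t \<in> ivl \<gamma>" "real K * t \<in> ivl \<gamma>"
    using ivl_downward[OF p] t(1) K' Kt by auto
  then show ?thesis
    using dilation_le_double[OF _ K _ t(3)] t(1) Kt by auto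
qed

lemma ex_dilation_le_double_near_top:
  assumes \<gamma>: "\<gamma> = \<infinity>" and L: "\<not> 1 < Liminf at_top (\<lambda>t. ereal (\<psi> (2 * t) / \<psi> t))"
    and K: "2 \<le> K"
  shows "\<exists>t\<ge>p. 0 < t \<and> \<psi> (real K * t) \<le> 2 * \<psi> t"
proof -
  have ivl: "s \<in> ivl \<gamma> \<longleftrightarrow> 0 < s" for s
    by (simp add: ivl_def \<gamma>)
  have K': "2 \<le> real K"
    using K by simp
  have "\<exists>\<^sub>F t in at_top. \<psi> (2 * t) / \<psi> t < 1 + 1 / real K"
    using L K' by (intro frequently_less_if_not_Liminf_greater) (simp_all add: one_ereal_def)
  moreover have "eventually (\<lambda>t. max p 0 < t) at_top"
    by (rule eventually_gt_at_top)
  ultimately obtain t where t: "max p 0 < t" "\<psi> (2 * t) / \<psi> t < 1 + 1 / real K"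
    by (metis (mono_tags, lifting) frequently_eventually_conj frequently_ex)
  then show ?thesis
    using dilation_le_double[OF _ K _ t(2)] K' ivl by (intro exI[of _ t]) auto
qed

lemma psi_le_double_if_le:
  assumes "\<psi> u \<le> 2 * \<psi> t" "t \<in> ivl \<gamma>" "\<tau> \<in> ivl \<gamma>" "t \<le> \<tau>"
  shows "\<psi> u \<le> 2 * \<psi> \<tau>"
  using psi_mono[of t \<tau>] assms by (auto simp: ivl_def)

lemma psi_slope_le_double_if_ge:
  assumes "\<psi> u \<le> 2 * \<psi> t" "t \<in> ivl \<gamma>" "0 < \<tau>" "\<tau> \<le> t"
  shows "\<tau> * (\<psi> u / t) \<le> 2 * \<psi> \<tau>"
proof -
  have "0 < t"
    using assms(2) by (simp add: ivl_def)
  then have "\<tau> * (\<psi> u / t) \<le> 2 * (\<tau> / t * \<psi> t)"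
    using assms(1,3) by (simp add: field_simps)
  also have "\<dots> \<le> 2 * \<psi> \<tau>"
    using psi_ratio_ge[of t \<tau>] assms(2-4) by (simp add: ivl_def)
  finally show ?thesis .
qed

lemma dilated_slope_le_half:
  assumes t: "t \<in> ivl \<gamma>" and double: "\<psi> u \<le> 2 * \<psi> t"
    and t': "0 < t'" and K: "4 \<le> K" and le: "K * t' \<le> t"
  shows "\<psi> u / t \<le> \<psi> (K * t') / t' / 2"
proof -
  have "0 < t" "0 < K * t'"
    using t t' K by (simp_all add: ivl_def)
  then have "\<psi> u / t \<le> 2 * (\<psi> t / t)"
    using double by (simp add: divide_right_mono)
  also have "\<dots> \<le> 2 * (\<psi> (K * t') / (K * t'))"
    using psi_div_antimono[of t "K * t'"] t le \<open>0 < K * t'\<close> by (simp add: ivl_def)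
  also have "\<dots> \<le> 2 * (\<psi> (K * t') / (4 * t'))"
    using psi_nonneg[of "K * t'"] ivl_downward[OF t \<open>0 < K * t'\<close> le] t' K
    by (intro mult_left_mono divide_left_mono mult_right_mono) (simp_all add: ivl_def)
  finally show ?thesis
    by simp
qed

text \<open>In both constructions below \<open>\<psi>((k + 8)t\<^sub>k) \<le> 2\<psi>(t\<^sub>k)\<close>; the terms of the series are bounded
  by \<open>\<psi>((k + 8)t\<^sub>k)\<close> and by \<open>\<tau> \<psi>((k + 8)t\<^sub>k)/t\<^sub>k\<close>, one of which halves on each side of the index
  where \<open>t\<^sub>k\<close> crosses \<open>\<tau>\<close>.\<close>

lemma dilated_sum_le_descending:
  fixes t :: "nat \<Rightarrow> real"
  assumes t: "\<And>k. 0 < t k" and u: "\<And>k. real (k + 8) * t k \<in> ivl \<gamma>"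
    and double: "\<And>k. \<psi> (real (k + 8) * t k) \<le> 2 * \<psi> (t k)"
    and shrink: "\<And>k. real (k + 9) * t (Suc k) \<le> t k"
    and halve: "\<And>k. \<psi> (real (k + 9) * t (Suc k)) \<le> \<psi> (real (k + 8) * t k) / 2"
    and \<tau>: "\<tau> \<in> ivl \<gamma>"
  shows "(\<Sum>k. ennreal (\<psi> (real (k + 8) * t k) * min 1 (\<tau> / t k))) \<le> ennreal (8 * \<psi> \<tau>)"
proof -
  define u where "u k = real (k + 8) * t k" for k
  have u_Suc: "u (Suc k) = real (k + 9) * t (Suc k)" for k
    by (simp add: u_def)
  have t_ivl: "t k \<in> ivl \<gamma>" for k
    using ivl_downward[OF u[of k] t[of k]] t[of k] by simp
  have \<tau>0: "0 < \<tau>"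
    using \<tau> by (simp add: ivl_def)
  have psi_u: "0 < \<psi> (u k)" for k
    using psi_pos[OF u[of k]] by (simp add: u_def)
  have slope_halve: "\<tau> * (\<psi> (u k) / t k) \<le> \<tau> * (\<psi> (u (Suc k)) / t (Suc k)) / 2" for k
  proof -
    have "\<psi> (u k) / t k \<le> \<psi> (u (Suc k)) / t (Suc k) / 2"
      unfolding u_Suc using double[of k] shrink[of k]
      by (intro dilated_slope_le_half[OF t_ivl _ t]) (simp_all add: u_def)
    then show ?thesis
      using \<tau>0 mult_left_mono[of _ _ \<tau>] by fastforce
  qed
  have "t (Suc k) \<le> t k / 2" for k
  proof -
    have "2 * t (Suc k) \<le> real (k + 9) * t (Suc k)"
      using t[of "Suc k"] by (intro mult_right_mono) auto
    with shrink[of k] show ?thesis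
      by linarith
  qed
  then have "\<exists>k. t k \<le> \<tau>"
    using \<tau>0 by (rule ex_le_if_halving)
  define m where "m = (LEAST k. t k \<le> \<tau>)"
  have "(\<Sum>k. ennreal (\<psi> (u k) * min 1 (\<tau> / t k))) \<le> ennreal (4 * (2 * \<psi> \<tau>))"
  proof (rule suminf_min_le_geometric[where p="\<lambda>k. \<psi> (u k)" and m=m])
    have "t m \<le> \<tau>"
      unfolding m_def by (rule LeastI_ex) fact
    then show "\<psi> (u m) \<le> 2 * \<psi> \<tau>"
      unfolding u_def by (rule psi_le_double_if_le[OF double t_ivl \<tau>])
    show "\<tau> * (\<psi> (u (m - 1)) / t (m - 1)) \<le> 2 * \<psi> \<tau>" if "0 < m"
    proof -
      have "\<not> t (m - 1) \<le> \<tau>"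
        using not_less_Least[of "m - 1" "\<lambda>k. t k \<le> \<tau>"] that by (simp add: m_def)
      then show ?thesis
        unfolding u_def by (intro psi_slope_le_double_if_ge[OF double t_ivl \<tau>0]) simp
    qed
  next
    show "\<psi> (u (Suc k)) \<le> \<psi> (u k) / 2" for k
      unfolding u_Suc using halve[of k] by (simp add: u_def)
  qed (use min_one_bounds[OF less_imp_le[OF psi_u] t \<tau>0] slope_halve in simp_all)
  then show ?thesis
    by (simp add: u_def)
qed

lemma dilated_sum_le_ascending:
  fixes t :: "nat \<Rightarrow> real"
  assumes t: "\<And>k. 0 < t k" and u: "\<And>k. real (k + 8) * t k \<in> ivl \<gamma>"
    and double: "\<And>k. \<psi> (real (k + 8) * t k) \<le> 2 * \<psi> (t k)"
    and grow: "\<And>k. real (k + 8) * t k \<le> t (Suc k)"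
    and double_up: "\<And>k. 2 * \<psi> (real (k + 8) * t k) \<le> \<psi> (real (k + 9) * t (Suc k))"
    and \<tau>: "\<tau> \<in> ivl \<gamma>"
  shows "(\<Sum>k. ennreal (\<psi> (real (k + 8) * t k) * min 1 (\<tau> / t k))) \<le> ennreal (8 * \<psi> \<tau>)"
proof -
  define u where "u k = real (k + 8) * t k" for k
  have u_Suc: "u (Suc k) = real (k + 9) * t (Suc k)" for k
    by (simp add: u_def)
  have t_ivl: "t k \<in> ivl \<gamma>" for k
    using ivl_downward[OF u[of k] t[of k]] t[of k] by simp
  have \<tau>0: "0 < \<tau>"
    using \<tau> by (simp add: ivl_def)
  have psi_u: "0 < \<psi> (u k)" for k
    using psi_pos[OF u[of k]] by (simp add: u_def)
  have slope_halve: "\<tau> * (\<psi> (u (Suc k)) / t (Suc k)) \<le> \<tau> * (\<psi> (u k) / t k) / 2" for k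
  proof -
    have "\<psi> (u (Suc k)) / t (Suc k) \<le> \<psi> (u k) / t k / 2"
      unfolding u_def using double[of "Suc k"] grow[of k]
      by (intro dilated_slope_le_half[OF t_ivl _ t]) simp_all
    then show ?thesis
      using \<tau>0 mult_left_mono[of _ _ \<tau>] by fastforce
  qed
  have "2 * t k \<le> real (k + 8) * t k" for k
    using t[of k] by (intro mult_right_mono) auto
  then have "2 * t k \<le> t (Suc k)" for k
    using grow[of k] order_trans by blast
  then have "\<exists>k. \<tau> < t k"
    using t[of 0] by (rule ex_gt_if_doubling)
  define m where "m = (LEAST k. \<tau> < t k)"
  have "(\<Sum>k. ennreal (\<psi> (u k) * min 1 (\<tau> / t k))) \<le> ennreal (4 * (2 * \<psi> \<tau>))"
  proof (rule suminf_min_le_geometric[where q="\<lambda>k. \<psi> (u k)" and m=m])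
    have "\<tau> < t m"
      unfolding m_def by (rule LeastI_ex) fact
    then show "\<tau> * (\<psi> (u m) / t m) \<le> 2 * \<psi> \<tau>"
      unfolding u_def by (intro psi_slope_le_double_if_ge[OF double t_ivl \<tau>0]) simp
    show "\<psi> (u (m - 1)) \<le> 2 * \<psi> \<tau>" if "0 < m"
    proof -
      have "\<not> \<tau> < t (m - 1)"
        using not_less_Least[of "m - 1" "\<lambda>k. \<tau> < t k"] that by (simp add: m_def)
      then show ?thesis
        unfolding u_def by (intro psi_le_double_if_le[OF double t_ivl \<tau>]) simp
    qed
  next
    show "\<psi> (u k) \<le> \<psi> (u (Suc k)) / 2" for k
      unfolding u_Suc using double_up[of k] by (simp add: u_def)
  qed (use min_one_bounds[OF less_imp_le[OF psi_u] t \<tau>0] slope_halve in simp_all)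
  then show ?thesis
    by (simp add: u_def)
qed

lemma ex_descending_dilation_sequence:
  assumes L: "\<not> 1 < Liminf (at_right 0) (\<lambda>t. ereal (\<psi> (2 * t) / \<psi> t))"
    and small: "\<And>y. 0 < y \<Longrightarrow> \<exists>s\<in>ivl \<gamma>. \<psi> s < y"
  obtains t :: "nat \<Rightarrow> real"
  where "\<And>k. 0 < t k" "\<And>k. real (k + 8) * t k \<in> ivl \<gamma>"
    "\<And>k. \<psi> (real (k + 8) * t k) \<le> 2 * \<psi> (t k)"
    "\<And>k. real (k + 9) * t (Suc k) \<le> t k"
    "\<And>k. \<psi> (real (k + 9) * t (Suc k)) \<le> \<psi> (real (k + 8) * t k) / 2"
proof -
  define P where "P k t \<longleftrightarrow> 0 < t \<and> real (k + 8) * t \<in> ivl \<gamma> \<and> \<psi> (real (k + 8) * t) \<le> 2 * \<psi> t"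
    for k t
  define Q where "Q k t t' \<longleftrightarrow>
      real (k + 9) * t' \<le> t \<and> \<psi> (real (k + 9) * t') \<le> \<psi> (real (k + 8) * t) / 2" for k t t'
  have "\<exists>t. P 0 t"
  proof -
    obtain b where b: "b \<in> ivl \<gamma>"
      using ex_in_ivl by blast
    then obtain t where "0 < t" "8 * t \<le> b" "\<psi> (8 * t) \<le> 2 * \<psi> t"
      using ex_dilation_le_double_near_zero[OF L, of 8] by auto
    then show ?thesis
      using ivl_downward[OF b, of "8 * t"] by (auto simp: P_def)
  qed
  moreover have "\<exists>t'. P (Suc k) t' \<and> Q k t t'" if "P k t" for k t
  proof -
    from that have t: "0 < t" "real (k + 8) * t \<in> ivl \<gamma>"
      by (simp_all add: P_def)
    have "0 < \<psi> (real (k + 8) * t) / 2"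
      using psi_pos[OF t(2)] by simp
    then obtain s where s: "s \<in> ivl \<gamma>" "\<psi> s < \<psi> (real (k + 8) * t) / 2"
      using small by blast
    have "t \<in> ivl \<gamma>"
      using ivl_downward[OF t(2) t(1)] t(1) by simp
    then have p: "min t s \<in> ivl \<gamma>"
      using s(1) by (simp add: min_def)
    obtain t' where t': "0 < t'" "real (k + 9) * t' \<le> min t s"
      "\<psi> (real (k + 9) * t') \<le> 2 * \<psi> t'"
      using ex_dilation_le_double_near_zero[OF L _ p, of "k + 9"] by auto
    have u': "real (k + 9) * t' \<in> ivl \<gamma>"
      using ivl_downward[OF p _ t'(2)] t'(1) by simp
    moreover have "\<psi> (real (k + 9) * t') \<le> \<psi> s"
      using u' s(1) t'(2) by (intro psi_mono) (auto simp: ivl_def)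
    ultimately show ?thesis
      using t' s(2) by (auto simp: P_def Q_def add.commute)
  qed
  ultimately obtain t where "\<And>k. P k (t k)" "\<And>k. Q k (t k) (t (Suc k))"
    using dependent_nat_choice[of P Q] by blast
  then show ?thesis
    by (intro that[of t]) (auto simp: P_def Q_def)
qed

lemma ex_ascending_dilation_sequence:
  assumes \<gamma>: "\<gamma> = \<infinity>" and L: "\<not> 1 < Liminf at_top (\<lambda>t. ereal (\<psi> (2 * t) / \<psi> t))"
    and large: "\<And>y. \<exists>s\<ge>0. y < \<psi> s"
  obtains t :: "nat \<Rightarrow> real"
  where "\<And>k. 0 < t k" "\<And>k. \<psi> (real (k + 8) * t k) \<le> 2 * \<psi> (t k)"
    "\<And>k. real (k + 8) * t k \<le> t (Suc k)"
    "\<And>k. 2 * \<psi> (real (k + 8) * t k) \<le> \<psi> (real (k + 9) * t (Suc k))"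
proof -
  define P where "P k t \<longleftrightarrow> 0 < t \<and> \<psi> (real (k + 8) * t) \<le> 2 * \<psi> t" for k t
  define Q where "Q k t t' \<longleftrightarrow>
      real (k + 8) * t \<le> t' \<and> 2 * \<psi> (real (k + 8) * t) \<le> \<psi> (real (k + 9) * t')" for k t t'
  have "\<exists>t. P 0 t"
    using ex_dilation_le_double_near_top[OF \<gamma> L, of 8] by (auto simp: P_def)
  moreover have "\<exists>t'. P (Suc k) t' \<and> Q k t t'" if "P k t" for k t
  proof -
    obtain s where s: "0 \<le> s" "2 * \<psi> (real (k + 8) * t) < \<psi> s"
      using large by blast
    obtain t' where t': "max (real (k + 8) * t) s \<le> t'" "0 < t'"
      "\<psi> (real (k + 9) * t') \<le> 2 * \<psi> t'"
      using ex_dilation_le_double_near_top[OF \<gamma> L, of "k + 9" "max (real (k + 8) * t) s"] by auto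
    have "t' \<le> real (k + 9) * t'"
      using t'(2) by simp
    then have "s \<le> real (k + 9) * t'"
      using t'(1) by simp
    then have "\<psi> s \<le> \<psi> (real (k + 9) * t')"
      using s(1) \<gamma> by (intro psi_mono) auto
    then show ?thesis
      using t' s(2) by (auto simp: P_def Q_def add.commute)
  qed
  ultimately obtain t where "\<And>k. P k (t k)" "\<And>k. Q k (t k) (t (Suc k))"
    using dependent_nat_choice[of P Q] by blast
  then show ?thesis
    by (intro that[of t]) (auto simp: P_def Q_def)
qed

lemma not_dual_order_continuous_at_zero:
  assumes L: "\<not> 1 < Liminf (at_right 0) (\<lambda>t. ereal (\<psi> (2 * t) / \<psi> t))"
  shows "\<not> dual_order_continuous \<gamma> \<psi>"
proof (cases "\<exists>c>0. \<forall>s\<in>ivl \<gamma>. c \<le> \<psi> s")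
  case True
  then show ?thesis
    using not_dual_order_continuous_if_psi_bounded_below by blast
next
  case False
  then have "\<exists>s\<in>ivl \<gamma>. \<psi> s < y" if "0 < y" for y
    using that by (meson not_le)
  then obtain t where t: "\<And>k. 0 < t k" "\<And>k. real (k + 8) * t k \<in> ivl \<gamma>"
    "\<And>k. \<psi> (real (k + 8) * t k) \<le> 2 * \<psi> (t k)" "\<And>k. real (k + 9) * t (Suc k) \<le> t k"
    "\<And>k. \<psi> (real (k + 9) * t (Suc k)) \<le> \<psi> (real (k + 8) * t k) / 2"
    using ex_descending_dilation_sequence[OF L] by blast
  have "disjoint_family (\<lambda>k. {t k<..<real (k + 8) * t k})"
    using t(1,4) by (intro disjoint_family_Ioo_descending) (simp_all add: add.commute)
  then show ?thesis
    using dilated_sum_le_descending[OF t]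
    by (rule not_dual_order_continuous_dilated_blocks[OF t(1,2)])
qed

lemma not_dual_order_continuous_at_top:
  assumes \<gamma>: "\<gamma> = \<infinity>" and L: "\<not> 1 < Liminf at_top (\<lambda>t. ereal (\<psi> (2 * t) / \<psi> t))"
  shows "\<not> dual_order_continuous \<gamma> \<psi>"
proof (cases "\<exists>C. \<forall>s\<ge>0. \<psi> s \<le> C")
  case True
  then show ?thesis
    using not_dual_order_continuous_if_psi_bounded[OF \<gamma>] by blast
next
  case False
  then have "\<exists>s\<ge>0. y < \<psi> s" for y
    by (meson not_le)
  then obtain t where t: "\<And>k. 0 < t k" "\<And>k. \<psi> (real (k + 8) * t k) \<le> 2 * \<psi> (t k)"
    "\<And>k. real (k + 8) * t k \<le> t (Suc k)"
    "\<And>k. 2 * \<psi> (real (k + 8) * t k) \<le> \<psi> (real (k + 9) * t (Suc k))"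
    using ex_ascending_dilation_sequence[OF \<gamma> L] by blast
  have u: "real (k + 8) * t k \<in> ivl \<gamma>" for k
    using t(1)[of k] by (simp add: ivl_def \<gamma>)
  have "disjoint_family (\<lambda>k. {t k<..<real (k + 8) * t k})"
    using t(1,3) by (intro disjoint_family_Ioo_ascending) simp_all
  then show ?thesis
    using dilated_sum_le_ascending[OF t(1) u t(2-4)]
    by (rule not_dual_order_continuous_dilated_blocks[OF t(1) u])
qed

end

theorem proposition5p3:
  fixes \<gamma> :: ereal and \<psi> :: "real \<Rightarrow> real"
  assumes "0 < \<gamma>"
    and "\<forall>t. 0 \<le> t \<and> ereal t < \<gamma> \<longrightarrow> 0 \<le> \<psi> t"
    and "\<exists>t. 0 \<le> t \<and> ereal t < \<gamma> \<and> \<psi> t \<noteq> 0"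
    and "mono_on {t. 0 \<le> t \<and> ereal t < \<gamma>} \<psi>"
    and "concave_on {t. 0 \<le> t \<and> ereal t < \<gamma>} \<psi>"
    and "continuous_on (ivl \<gamma>) \<psi>"
    and "\<psi> 0 = 0"
    and "dual_order_continuous \<gamma> \<psi>"
  shows "condA \<gamma> \<psi> \<or> condB \<gamma> \<psi>"
proof (rule ccontr)
  interpret concave_weight \<gamma> \<psi>
    using assms by unfold_locales auto
  assume "\<not> (condA \<gamma> \<psi> \<or> condB \<gamma> \<psi>)"
  then have "\<not> 1 < Liminf (at_right 0) (\<lambda>t. ereal (\<psi> (2 * t) / \<psi> t))
      \<or> \<gamma> = \<infinity> \<and> \<not> 1 < Liminf at_top (\<lambda>t. ereal (\<psi> (2 * t) / \<psi> t))"
    by (cases \<gamma>) (auto simp: condA_def condB_def)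
  then show False
    using not_dual_order_continuous_at_zero not_dual_order_continuous_at_top assms(8) by blast
qed

end
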